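(* Let $\alpha\ge 1$, $\beta\ge 0$ and let $\mathcal{C}\subseteq \mathbb{Z}_2^\alpha\times\mathbb{Z}_4^\beta$ be a $\mathbb{Z}_2\mathbb{Z}_4$-additive 1-perfect code whose Gray image $\Phi(\mathcal{C})$ is not a binary linear code. If $\mathcal{C}$ is $\mathbb{Z}_2\mathbb{Z}_4$-cyclic, then $\alpha=3$, $\beta=6$, $\mathcal{C}$ has type $(3,6;3,4;3)$, and $\mathcal{C}$ coincides with $\mathcal{C}^*$ up to a permutation of the $\mathbb{Z}_2$ coordinates and a permutation of the $\mathbb{Z}_4$ coordinates. Moreover, $\mathcal{C}^*$ is a $\mathbb{Z}_2\mathbb{Z}_4$-cyclic 1-perfect code of type $(3,6;3,4;3)$.
   Context: A $\mathbb{Z}_2\mathbb{Z}_4$-additive code is an additive subgroup $\mathcal{C}$ of $\mathbb{Z}_2^\alpha\times\mathbb{Z}_4^\beta$; vectors are written $\mathbf{u}=(u\mid u')$ with $u\in\mathbb{Z}_2^\alpha$, $u'\in\mathbb{Z}_4^\beta$. The $X$ part is the first $\alpha$ (binary) coordinates, the $Y$ part the last $\beta$ (quaternary) coordinates; for a set $S$ of vectors, $S_X$ denotes the set of projections onto the $X$ coordinates. The Gray map $\phi:\mathbb{Z}_4\to\mathbb{Z}_2^2$ is $\phi(0)=(0,0),\phi(1)=(0,1),\phi(2)=(1,1),\phi(3)=(1,0)$, and $\Phi(u\mid u')=(u\mid \phi(u'_1),\dots,\phi(u'_\beta))\in\mathbb{Z}_2^{\alpha+2\beta}$; $\Phi(\mathcal{C})$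 is the Gray image. A binary code $C\subseteq\mathbb{Z}_2^n$ is 1-perfect if the Hamming balls of radius 1 around its codewords partition $\mathbb{Z}_2^n$; a $\mathbb{Z}_2\mathbb{Z}_4$-additive code is called 1-perfect if its Gray image is 1-perfect. If $\mathcal{C}\cong\mathbb{Z}_2^\gamma\times\mathbb{Z}_4^\delta$ as a group, $\mathcal{C}_b$ is the subgroup of codewords of order at most 2, and $\kappa$ is the dimension of the binary linear code $(\mathcal{C}_b)_X$, then $\mathcal{C}$ is said to have type $(\alpha,\beta;\gamma,\delta;\kappa)$. The cyclic shift is $\sigma(v_1,\dots,v_m)=(v_m,v_1,\dots,v_{m-1})$, and for $\mathbf{u}=(u\mid u')$ one sets $\sigma(\mathbf{u})=(\sigma(u)\mid\sigma(u'))$; $\mathcal{C}$ is $\mathbb{Z}_2\mathbb{Z}_4$-cyclic if $\sigma(\mathbf{x})\in\mathcal{C}$ for all $\mathbf{x}\in\mathcal{C}$. The inner product on $\mathbb{Z}_2^\alpha\times\mathbb{Z}_4^\beta$ is $\mathbf{u}\cdot\mathbf{v}=2\sum_{i=1}^\alpha u_iv_i+\sum_{j=1}^\beta u'_jv'_j\in\mathbb{Z}_4$ (binary entries read as $0,1\in\mathbb{Z}_4$). $\mathcal{C}^*\subseteq\mathbb{Z}_2^3\times\mathbb{Z}_4^6$ is the set of vectors $\mathbf{v}$ with $\mathbf{h}_1\cdot\mathbf{v}=\mathbf{h}_2\cdot\mathbf{v}=0$, where $\mathbf{h}_1=(1,1,0\mid 1,1,2,3,1,0)$ and $\mathbf{h}_2=(0,1,1\mid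 0,1,1,2,3,1)$. *)

theory Defs
  imports Main "HOL-Combinatorics.Permutations"
begin

text \<open>Vectors of Z2^alpha x Z4^beta are pairs of nat lists (u, u'), with
  entries of u in {0,1} and entries of u' in {0,1,2,3}.\<close>

type_synonym z2z4vec = "nat list \<times> nat list"

definition ambient :: "nat \<Rightarrow> nat \<Rightarrow> z2z4vec set" where
  "ambient a b = {(u, v). length u = a \<and> length v = b \<and>
                          set u \<subseteq> {0, 1} \<and> set v \<subseteq> {0, 1, 2, 3}}"

definition vadd :: "z2z4vec \<Rightarrow> z2z4vec \<Rightarrow> z2z4vec" where
  "vadd x y = (map2 (\<lambda>a b. (a + b) mod 2) (fst x) (fst y),
               map2 (\<lambda>a b. (a + b) mod 4) (snd x) (snd y))"

definition vneg :: "z2z4vec \<Rightarrow> z2z4vec" where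
  "vneg x = (fst x, map (\<lambda>a. (4 - a) mod 4) (snd x))"

definition vzero :: "nat \<Rightarrow> nat \<Rightarrow> z2z4vec" where
  "vzero a b = (replicate a 0, replicate b 0)"

definition additive_code :: "nat \<Rightarrow> nat \<Rightarrow> z2z4vec set \<Rightarrow> bool" where
  "additive_code a b C \<longleftrightarrow> C \<subseteq> ambient a b \<and> vzero a b \<in> C \<and>
     (\<forall>x\<in>C. \<forall>y\<in>C. vadd x y \<in> C) \<and> (\<forall>x\<in>C. vneg x \<in> C)"

definition gray :: "nat \<Rightarrow> nat list" where
  "gray z = (if z = 0 then [0, 0] else if z = 1 then [0, 1]
             else if z = 2 then [1, 1] else [1, 0])"

definition Gray :: "z2z4vec \<Rightarrow> nat list" where
  "Gray x = fst x @ concat (map gray (snd x))"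

definition binspace :: "nat \<Rightarrow> nat list set" where
  "binspace n = {x. length x = n \<and> set x \<subseteq> {0, 1}}"

definition hamming :: "nat list \<Rightarrow> nat list \<Rightarrow> nat" where
  "hamming x y = card {i. i < length x \<and> x ! i \<noteq> y ! i}"

definition one_perfect :: "nat \<Rightarrow> nat list set \<Rightarrow> bool" where
  "one_perfect n C \<longleftrightarrow> C \<subseteq> binspace n \<and>
     (\<forall>x\<in>binspace n. \<exists>!c. c \<in> C \<and> hamming x c \<le> 1)"

definition binary_linear :: "nat \<Rightarrow> nat list set \<Rightarrow> bool" where
  "binary_linear n C \<longleftrightarrow> C \<subseteq> binspace n \<and> replicate n 0 \<in> C \<and>
     (\<forall>x\<in>C. \<forall>y\<in>C. map2 (\<lambda>a b. (a + b) mod 2) x y \<in> C)"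

definition z2z4_one_perfect :: "nat \<Rightarrow> nat \<Rightarrow> z2z4vec set \<Rightarrow> bool" where
  "z2z4_one_perfect a b C \<longleftrightarrow> one_perfect (a + 2 * b) (Gray ` C)"

text \<open>Type (alpha, beta; gamma, delta; kappa).  C is isomorphic as a group to
  Z2^gamma x Z4^delta; kappa = dim (C_b)_X, where (C_b)_X is a binary
  linear code, so its dimension is given by card = 2^kappa.\<close>
definition group_iso_type :: "z2z4vec set \<Rightarrow> nat \<Rightarrow> nat \<Rightarrow> bool" where
  "group_iso_type C g d \<longleftrightarrow> (\<exists>f. bij_betw f C (ambient g d) \<and>
      (\<forall>x\<in>C. \<forall>y\<in>C. f (vadd x y) = vadd (f x) (f y)))"

definition Cb :: "nat \<Rightarrow> nat \<Rightarrow> z2z4vec set \<Rightarrow> z2z4vec set" where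
  "Cb a b C = {x \<in> C. vadd x x = vzero a b}"

definition has_type :: "z2z4vec set \<Rightarrow> nat \<Rightarrow> nat \<Rightarrow> nat \<Rightarrow> nat \<Rightarrow> nat \<Rightarrow> bool" where
  "has_type C a b g d k \<longleftrightarrow> additive_code a b C \<and> group_iso_type C g d \<and>
      card (fst ` Cb a b C) = 2 ^ k"

definition cshift :: "'a list \<Rightarrow> 'a list" where
  "cshift xs = (if xs = [] then [] else last xs # butlast xs)"

definition z2z4_cyclic :: "z2z4vec set \<Rightarrow> bool" where
  "z2z4_cyclic C \<longleftrightarrow> (\<forall>x\<in>C. (cshift (fst x), cshift (snd x)) \<in> C)"

definition ip :: "z2z4vec \<Rightarrow> z2z4vec \<Rightarrow> nat" where
  "ip x y = (2 * (\<Sum>i<length (fst x). fst x ! i * fst y ! i)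
             + (\<Sum>j<length (snd x). snd x ! j * snd y ! j)) mod 4"

definition h1 :: z2z4vec where "h1 = ([1, 1, 0], [1, 1, 2, 3, 1, 0])"
definition h2 :: z2z4vec where "h2 = ([0, 1, 1], [0, 1, 1, 2, 3, 1])"

definition Cstar :: "z2z4vec set" where
  "Cstar = {v \<in> ambient 3 6. ip h1 v = 0 \<and> ip h2 v = 0}"

definition permute_list_by :: "(nat \<Rightarrow> nat) \<Rightarrow> 'a list \<Rightarrow> 'a list" where
  "permute_list_by p xs = map (\<lambda>i. xs ! p i) [0..<length xs]"

definition perm_equiv :: "nat \<Rightarrow> nat \<Rightarrow> z2z4vec set \<Rightarrow> z2z4vec set \<Rightarrow> bool" where
  "perm_equiv a b C D \<longleftrightarrow> (\<exists>p q. p permutes {0..<a} \<and> q permutes {0..<b} \<and>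
      C = (\<lambda>x. (permute_list_by p (fst x), permute_list_by q (snd x))) ` D)"

end

theory Submission
  imports Defs "HOL-Library.Function_Algebras" "HOL-Library.Product_Plus"
begin

text \<open>Let $G$ be the quotient of the ambient group by $C$. Perfectness says that the non-zero
  elements of $G$ are, without repetition, the classes $e_i$ of the binary unit vectors and the
  classes $\pm q_j$ of the quaternary ones. The $e_i$ are exactly the elements of order 2, so
  $2 q_0$ is some $e_i$, and applying the shift gives $2 q_j = e_{i+j}$. Counting the $x$ with
  $2x = 2q_0$ yields $\alpha + 1 = 2\beta/\alpha$. Since $q_\alpha = q_0 + g$ with $2g = 0$ and the
  $\alpha$-fold shift fixes $g$, we get $q_{2\alpha} = q_0$, that is $\beta \mid 2\alpha$. Hence
  $(\alpha,\beta)$ is $(1,1)$, where the Gray image is linear, or $(3,6)$. In the latter case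
  $q_{j+2} = q_j \pm q_{j+1}$ for all $j$, and both signs give \<open>Cstar\<close> after relabelling.\<close>

section \<open>Gray weight and single errors\<close>

text \<open>Two obstacles shape the proof. Lists of residues do not form a group type, so classes
  are handled through integer lifts, an abelian group under pointwise operations; the quotient
  appears only as congruence modulo the set \<open>S\<close> of lifts that reduce into the code. And
  the Gray map is not additive; but it is an isometry for the Lee metric, so distances depend only
  on differences, and perfectness becomes a statement about cosets.

  The sign relation comes from doubling. For three binary coordinates the classes \<open>e i\<close>
  and 0 form a Klein four-group, so \<open>q 0 + q 1\<close> and \<open>q 2\<close> have the same
  double and differ by 2-torsion, that is by 0 or by twice some \<open>q k\<close>; this only
  changes signs. The choices with \<open>- q 0\<close> are impossible, since they give that
  \<open>q 3\<close> is \<open>q 0\<close> or \<open>- q 0\<close>. The entries of \<open>h1\<close>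
  and \<open>h2\<close> are then consecutive Fibonacci numbers modulo 4, where the Fibonacci
  sequence has period 6.\<close>

type_synonym lift = "(nat \<Rightarrow> int) \<times> (nat \<Rightarrow> int)"

text \<open>Reduction of integer lifts to the ambient group: a surjective homomorphism, so that
  type-class algebra on lifts replaces arithmetic on lists. Only indices below \<open>a\<close> and
  \<open>b\<close> are read.\<close>

definition vec :: "nat \<Rightarrow> nat \<Rightarrow> lift \<Rightarrow> z2z4vec" where
  "vec a b w = (map (\<lambda>i. nat (fst w i mod 2)) [0..<a], map (\<lambda>j. nat (snd w j mod 4)) [0..<b])"

lemma vec_eq_iff:
  "vec a b w = vec a b w' \<longleftrightarrow>
     (\<forall>i<a. 2 dvd fst w i - fst w' i) \<and> (\<forall>j<b. 4 dvd snd w j - snd w' j)"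
proof -
  have "nat (x mod 2) = nat (y mod 2) \<longleftrightarrow> 2 dvd x - y"
    "nat (x mod 4) = nat (y mod 4) \<longleftrightarrow> 4 dvd x - y" for x y :: int
    by (simp_all only: mod_eq_dvd_iff[symmetric]) (simp_all add: eq_nat_nat_iff)
  then show ?thesis by (auto simp: vec_def)
qed

lemma vec_add: "vec a b (w + w') = vadd (vec a b w) (vec a b w')"
proof -
  have "nat ((x + y) mod m) = (nat (x mod m) + nat (y mod m)) mod nat m" if "m > 0" for x y m :: int
    using that by (simp add: nat_add_distrib[symmetric] nat_mod_distrib[symmetric] mod_simps)
  from this[of 2] this[of 4] show ?thesis
    by (auto simp: vec_def vadd_def list_eq_iff_nth_eq)
qed

lemma vec_uminus: "vec a b (- w) = vneg (vec a b w)"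
proof -
  have "- x mod 2 = x mod 2" for x :: int
    by presburger
  moreover have "nat (- x mod 4) = (4 - nat (x mod 4)) mod 4" for x :: int
  proof -
    have "x mod 4 \<in> {0,1,2,3}" "- x mod 4 = (4 - x mod 4) mod 4"
      unfolding insert_iff empty_iff by presburger+
    then show ?thesis by auto
  qed
  ultimately show ?thesis
    by (auto simp: vec_def vneg_def)
qed

lemma vec_zero: "vec a b 0 = vzero a b"
  by (auto simp: vec_def vzero_def list_eq_iff_nth_eq)

lemma vec_in_ambient: "vec a b w \<in> ambient a b"
proof -
  have "x mod 2 \<in> {0,1}" "x mod 4 \<in> {0,1,2,3}" for x :: int
    unfolding insert_iff empty_iff by presburger+
  then have "nat (x mod 2) \<in> {0,1}" "nat (x mod 4) \<in> {0,1,2,3}" for x :: int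
    by fastforce+
  then show ?thesis
    unfolding ambient_def vec_def by auto
qed

lemma ambient_obtain_vec:
  assumes "x \<in> ambient a b"
  obtains w where "x = vec a b w"
proof -
  have len: "length (fst x) = a" "length (snd x) = b"
    and s: "set (fst x) \<subseteq> {0, 1}" "set (snd x) \<subseteq> {0, 1, 2, 3}"
    using assms by (auto simp: ambient_def)
  have 1: "fst x ! i < 2" if "i < a" for i
    using s(1) len nth_mem[of i "fst x"] that by fastforce
  have 2: "snd x ! i < 4" if "i < b" for i
    using s(2) len nth_mem[of i "snd x"] that by fastforce
  have "x = vec a b (\<lambda>i. int (fst x ! i), \<lambda>j. int (snd x ! j))"
    using len 1 2 by (auto simp: vec_def list_eq_iff_nth_eq prod_eq_iff)
  then show ?thesis by (rule that)
qed

section \<open>Hamming distance of Gray images as Lee weight of differences\<close>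

lemma hamming_Nil [simp]: "hamming [] [] = 0"
  by (simp add: hamming_def)

lemma hamming_Cons [simp]: "hamming (x # xs) (y # ys) = of_bool (x \<noteq> y) + hamming xs ys"
proof -
  have "{i. i < length (x # xs) \<and> (x # xs) ! i \<noteq> (y # ys) ! i} =
    (if x \<noteq> y then {0} else {}) \<union> Suc ` {i. i < length xs \<and> xs ! i \<noteq> ys ! i}"
    (is "?A = _")
    by (auto simp: less_Suc_eq_0_disj)
  then show ?thesis
    unfolding hamming_def by (auto simp: card_image card_insert_if)
qed

lemma hamming_append:
  "length xs = length ys \<Longrightarrow> hamming (xs @ xs') (ys @ ys') = hamming xs ys + hamming xs' ys'"
  by (induction xs ys rule: list_induct2) auto

lemma hamming_map:
  "hamming (map f [0..<n]) (map g [0..<n]) = (\<Sum>i<n. of_bool (f i \<noteq> g i))"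
  by (induction n) (auto simp: hamming_append)

lemma length_gray [simp]: "length (gray z) = 2"
  by (simp add: gray_def)

lemma length_concat_gray [simp]: "length (concat (map gray v)) = 2 * length v"
  by (induction v) auto

lemma hamming_concat_gray:
  "hamming (concat (map (\<lambda>j. gray (f j)) [0..<n])) (concat (map (\<lambda>j. gray (g j)) [0..<n]))
     = (\<Sum>j<n. hamming (gray (f j)) (gray (g j)))"
proof (induction n)
  case (Suc n)
  have "length (concat (map (\<lambda>j. gray (f j)) [0..<n])) = 2 * n" for f
    using length_concat_gray[of "map f [0..<n]"] by (simp add: comp_def)
  then show ?case using Suc by (simp add: hamming_append)
qed simp

text \<open>The Lee weight on the integers modulo 4, read off an integer representative.\<close>

definition lee :: "int \<Rightarrow> nat" where
  "lee z = (if 4 dvd z then 0 else if even z then 2 else 1)"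

definition weight :: "nat \<Rightarrow> nat \<Rightarrow> lift \<Rightarrow> nat" where
  "weight a b w = (\<Sum>i<a. of_bool (odd (fst w i))) + (\<Sum>j<b. lee (snd w j))"

text \<open>The Gray map is an isometry from the Lee metric to the Hamming metric: a finite check
  over the sixteen pairs of residues.\<close>

lemma hamming_gray:
  "hamming (gray (nat (x mod 4))) (gray (nat (y mod 4))) = lee (x - y)"
proof -
  have "x mod 4 \<in> {0,1,2,3}" "y mod 4 \<in> {0,1,2,3}"
    unfolding insert_iff empty_iff by presburger+
  moreover have "4 dvd x - y \<longleftrightarrow> x mod 4 = y mod 4"
    by (simp add: mod_eq_dvd_iff)
  moreover have "even (x - y) \<longleftrightarrow> even (x mod 4) = even (y mod 4)"
    by presburger
  moreover have "hamming (gray (nat p)) (gray (nat q)) = (if p = q then 0 else if even p = even q then 2 else 1)"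
    if "p \<in> {0,1,2,3}" "q \<in> {0,1,2,3}" for p q :: int
  proof -
    have "p = 0 \<or> p = 1 \<or> p = 2 \<or> p = 3" "q = 0 \<or> q = 1 \<or> q = 2 \<or> q = 3"
      using that by simp_all
    then show ?thesis by (elim disjE) (simp_all add: gray_def)
  qed
  ultimately show ?thesis
    unfolding lee_def by (simp only: if_True)
qed

text \<open>Although \<open>Gray\<close> is not additive, the distance is translation invariant.
  This is what turns Hamming balls into translates of one fixed set of errors.\<close>

lemma hamming_Gray:
  "hamming (Gray (vec a b w)) (Gray (vec a b w')) = weight a b (w - w')"
proof -
  have "nat (x mod 2) \<noteq> nat (y mod 2) \<longleftrightarrow> odd (x - y)" for x y :: int
    by (simp add: nat_eq_iff) presburger
  then show ?thesis
    by (simp add: Gray_def vec_def hamming_append hamming_map comp_def hamming_concat_gray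
        hamming_gray weight_def)
qed

lemma lee_eq_0_iff [simp]: "lee z = 0 \<longleftrightarrow> 4 dvd z"
  by (simp add: lee_def)

lemma weight_eq_0_iff: "weight a b w = 0 \<longleftrightarrow> vec a b w = vec a b 0"
  by (auto simp: weight_def vec_eq_iff)

lemma weight_cong: "vec a b w = vec a b w' \<Longrightarrow> weight a b w = weight a b w'"
proof -
  assume h: "vec a b w = vec a b w'"
  have "odd (fst w i) = odd (fst w' i)" if "i < a" for i
  proof -
    have "2 dvd fst w i - fst w' i" using h that by (auto simp: vec_eq_iff)
    then show ?thesis by presburger
  qed
  moreover have "lee (snd w i) = lee (snd w' i)" if "i < b" for i
  proof -
    have 1: "4 dvd snd w i - snd w' i" using h that by (auto simp: vec_eq_iff)
    then have "4 dvd snd w i \<longleftrightarrow> 4 dvd snd w' i" by presburger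
    moreover have "even (snd w i) = even (snd w' i)" using 1 by presburger
    ultimately show ?thesis by (simp add: lee_def)
  qed
  ultimately show ?thesis by (simp add: weight_def)
qed

lemma Gray_eq_iff: "Gray (vec a b w) = Gray (vec a b w') \<longleftrightarrow> vec a b w = vec a b w'"
proof
  assume "Gray (vec a b w) = Gray (vec a b w')"
  then have "weight a b (w - w') = 0"
    unfolding hamming_Gray[symmetric] by (simp add: hamming_def)
  then show "vec a b w = vec a b w'"
    by (simp add: weight_eq_0_iff vec_eq_iff)
qed simp

lemma Gray_in_binspace: "x \<in> ambient a b \<Longrightarrow> Gray x \<in> binspace (a + 2 * b)"
proof -
  assume x: "x \<in> ambient a b"
  have "set (gray z) \<subseteq> {0, 1}" for z by (simp add: gray_def)
  then have "set (concat (map gray v)) \<subseteq> {0, 1}" for v by (induction v) auto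
  with x show ?thesis by (auto simp: ambient_def binspace_def Gray_def)
qed

lemma gray_list_surj:
  "length v = 2 * n \<Longrightarrow> set v \<subseteq> {0, 1} \<Longrightarrow>
     \<exists>y. length y = n \<and> set y \<subseteq> {0, 1, 2, 3} \<and> concat (map gray y) = v"
proof (induction n arbitrary: v)
  case (Suc n)
  then obtain s t v' where v: "v = s # t # v'" "length v' = 2 * n" "set v' \<subseteq> {0, 1}"
    by (auto simp: length_Suc_conv)
  then obtain y where y: "length y = n" "set y \<subseteq> {0, 1, 2, 3}" "concat (map gray y) = v'"
    using Suc.IH by blast
  have "s \<in> {0, 1}" "t \<in> {0, 1}" using Suc.prems v by auto
  then have "\<exists>z\<in>{0, 1, 2, 3}. gray z = [s, t]" by (auto simp: gray_def)
  then obtain z where "z \<in> {0, 1, 2, 3}" "gray z = [s, t]" by blast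
  with y v show ?case by (intro exI[of _ "z # y"]) auto
qed simp

lemma binspace_obtain_Gray:
  assumes "x \<in> binspace (a + 2 * b)"
  obtains w where "x = Gray (vec a b w)"
proof -
  have l: "length x = a + 2 * b" "set x \<subseteq> {0, 1}"
    using assms by (auto simp: binspace_def)
  obtain y where y: "length y = b" "set y \<subseteq> {0, 1, 2, 3}" "concat (map gray y) = drop a x"
    using gray_list_surj[of "drop a x" b] l set_drop_subset[of a x] by auto
  have "(take a x, y) \<in> ambient a b"
    using l y set_take_subset[of a x] by (auto simp: ambient_def)
  then obtain w where "(take a x, y) = vec a b w" by (rule ambient_obtain_vec)
  moreover have "x = Gray (take a x, y)" using y by (simp add: Gray_def)
  ultimately show ?thesis using that by metis
qed

text \<open>Unit vectors are extended periodically, in the index and in the argument. The cyclic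
  shift then takes the unit of index \<open>i\<close> to that of index \<open>Suc i\<close> as an
  equality of functions, with no wrap-around case.\<close>

definition bin_unit :: "nat \<Rightarrow> nat \<Rightarrow> lift" where
  "bin_unit a i = (\<lambda>k. of_bool (k mod a = i mod a), 0)"

definition quat_unit :: "nat \<Rightarrow> nat \<Rightarrow> lift" where
  "quat_unit b j = (0, \<lambda>k. of_bool (k mod b = j mod b))"

text \<open>One lift for each vector of weight at most 1. Only quaternary units come with both
  signs, because 1 and -1 agree modulo 2.\<close>

definition errors :: "nat \<Rightarrow> nat \<Rightarrow> lift set" where
  "errors a b = {0} \<union> bin_unit a ` {..<a} \<union> quat_unit b ` {..<b} \<union> (\<lambda>j. - quat_unit b j) ` {..<b}"

lemma sum_le_1:
  fixes f :: "'a \<Rightarrow> nat"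
  assumes "finite A" "sum f A \<le> 1"
  shows "(\<forall>i\<in>A. f i = 0) \<or> (\<exists>i\<in>A. f i = 1 \<and> (\<forall>j\<in>A - {i}. f j = 0))"
proof (cases "\<forall>i\<in>A. f i = 0")
  case False
  then obtain i where i: "i \<in> A" "f i \<noteq> 0" by blast
  have "sum f A = f i + sum f (A - {i})" using assms i by (simp add: sum.remove)
  then have "f i = 1" "sum f (A - {i}) = 0" using assms i by linarith+
  then show ?thesis using i assms by auto
qed simp

lemma weight_bin_unit: "i < a \<Longrightarrow> weight a b (bin_unit a i) = 1"
proof -
  assume i: "i < a"
  have "(\<Sum>k<a. of_bool (odd (of_bool (k mod a = i mod a) :: int))) = (\<Sum>k<a. of_bool (k = i) :: nat)"
    using i by (intro sum.cong) auto
  then show ?thesis using i by (simp add: weight_def bin_unit_def lee_def)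
qed

lemma weight_quat_unit:
  assumes "j < b"
  shows "weight a b (quat_unit b j) = 1" "weight a b (- quat_unit b j) = 1"
proof -
  have "(\<Sum>k<b. lee (of_bool (k mod b = j mod b))) = (\<Sum>k<b. of_bool (k = j) :: nat)"
    using assms by (intro sum.cong) (auto simp: lee_def)
  then show "weight a b (quat_unit b j) = 1" using assms by (simp add: weight_def quat_unit_def)
  have "(\<Sum>k<b. lee (- of_bool (k mod b = j mod b))) = (\<Sum>k<b. of_bool (k = j) :: nat)"
    using assms by (intro sum.cong) (auto simp: lee_def)
  then show "weight a b (- quat_unit b j) = 1" using assms by (simp add: weight_def quat_unit_def)
qed

lemma weight_le_1_iff:
  "weight a b w \<le> 1 \<longleftrightarrow> (\<exists>x\<in>errors a b. vec a b w = vec a b x)"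
proof
  assume "\<exists>x\<in>errors a b. vec a b w = vec a b x"
  then obtain x where x: "x \<in> errors a b" "weight a b w = weight a b x"
    using weight_cong by blast
  then show "weight a b w \<le> 1"
    using weight_eq_0_iff[of a b 0] by (auto simp: errors_def weight_bin_unit weight_quat_unit)
next
  assume w: "weight a b w \<le> 1"
  let ?X = "\<Sum>i<a. of_bool (odd (fst w i)) :: nat" and ?Y = "\<Sum>j<b. lee (snd w j)"
  have XY: "?X + ?Y \<le> 1" using w by (simp add: weight_def)
  consider "?X = 0" "?Y = 0" | "?X = 1" "?Y = 0" | "?X = 0" "?Y = 1" using XY by linarith
  then show "\<exists>x\<in>errors a b. vec a b w = vec a b x"
  proof cases
    case 1
    then have "weight a b w = 0" by (simp add: weight_def)
    then show ?thesis unfolding weight_eq_0_iff by (auto simp: errors_def)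
  next
    case 2
    have "\<not> (\<forall>i\<in>{..<a}. (of_bool (odd (fst w i)) :: nat) = 0)"
      using \<open>?X = 1\<close> by (metis (no_types, lifting) sum.neutral zero_neq_one)
    then obtain i where i: "i < a" "odd (fst w i)" "\<forall>k\<in>{..<a} - {i}. even (fst w k)"
      using sum_le_1[of "{..<a}" "\<lambda>i. of_bool (odd (fst w i))"] 2 by auto
    have "\<forall>j<b. 4 dvd snd w j" using 2(2) by (auto simp: lee_def split: if_splits)
    then have "vec a b w = vec a b (bin_unit a i)"
      unfolding vec_eq_iff bin_unit_def using i by auto
    then show ?thesis using i by (auto simp: errors_def)
  next
    case 3
    have e: "\<forall>i<a. even (fst w i)" using 3(1) by auto
    have "\<not> (\<forall>i\<in>{..<b}. lee (snd w i) = 0)"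
      using \<open>?Y = 1\<close> by (metis (no_types, lifting) sum.neutral zero_neq_one)
    then obtain j where j: "j < b" "lee (snd w j) = 1" "\<forall>k\<in>{..<b} - {j}. lee (snd w k) = 0"
      using sum_le_1[of "{..<b}" "\<lambda>j. lee (snd w j)"] 3 by auto
    have o: "\<forall>k<b. k \<noteq> j \<longrightarrow> 4 dvd snd w k" using j(3) by (auto simp: lee_def split: if_splits)
    have "odd (snd w j)" using j(2) by (auto simp: lee_def split: if_splits)
    then have "4 dvd snd w j - 1 \<or> 4 dvd snd w j + 1" by presburger
    then have "vec a b w = vec a b (quat_unit b j) \<or> vec a b w = vec a b (- quat_unit b j)"
      unfolding vec_eq_iff quat_unit_def using e o j(1) by auto
    then show ?thesis using j(1) by (auto simp: errors_def)
  qed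
qed

lemma errors_entries:
  assumes "x \<in> errors a b"
  shows "fst x k \<in> {0, 1}" "snd x k \<in> {- 1, 0, 1}"
    and "fst x k = (if a = 0 then 0 else fst x (k mod a))"
    and "snd x k = (if b = 0 then 0 else snd x (k mod b))"
  using assms by (auto simp: errors_def bin_unit_def quat_unit_def)

text \<open>Entries of errors lie in 0, 1 on the binary side and in -1, 0, 1 on the quaternary side,
  so two of them are too close to differ by a nonzero multiple of 2 or of 4 respectively.
  Periodicity carries the equality from the coordinate range to all indices.\<close>

lemma inj_on_vec_errors: "inj_on (vec a b) (errors a b)"
proof (rule inj_onI)
  fix x y assume x: "x \<in> errors a b" and y: "y \<in> errors a b" and v: "vec a b x = vec a b y"
  have X: "fst x k = fst y k" if "k < a" for k
  proof -
    have "2 dvd fst x k - fst y k" using v that by (auto simp: vec_eq_iff)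
    then show ?thesis using errors_entries(1)[OF x, of k] errors_entries(1)[OF y, of k] by auto
  qed
  have Y: "snd x k = snd y k" if "k < b" for k
  proof -
    have "4 dvd snd x k - snd y k" using v that by (auto simp: vec_eq_iff)
    then show ?thesis using errors_entries(2)[OF x, of k] errors_entries(2)[OF y, of k] by auto
  qed
  have "fst x k = fst y k" "snd x k = snd y k" for k
    using X[of "k mod a"] Y[of "k mod b"] errors_entries(3,4)[OF x, of k] errors_entries(3,4)[OF y, of k]
    by (simp_all split: if_splits)
  then show "x = y" by (simp add: prod_eq_iff fun_eq_iff)
qed

text \<open>The codewords within distance 1 of \<open>w\<close> are the \<open>w - x\<close> with
  \<open>x\<close> an error, and different errors yield different codewords. Hence perfectness says
  that the errors form a transversal of the cosets of the code.\<close>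

lemma one_perfect_iff:
  assumes "additive_code a b C"
  shows "z2z4_one_perfect a b C \<longleftrightarrow> (\<forall>w. \<exists>!x. x \<in> errors a b \<and> vec a b (w - x) \<in> C)"
proof -
  have amb: "C \<subseteq> ambient a b" using assms by (simp add: additive_code_def)
  show ?thesis
  proof (intro iffI allI)
    fix w
    assume "z2z4_one_perfect a b C"
    then have P: "\<exists>!c. c \<in> Gray ` C \<and> hamming (Gray (vec a b w)) c \<le> 1"
      using Gray_in_binspace[OF vec_in_ambient] by (simp add: z2z4_one_perfect_def one_perfect_def)
    then obtain c where c: "c \<in> C" "hamming (Gray (vec a b w)) (Gray c) \<le> 1" by blast
    then obtain w' where w': "c = vec a b w'" using amb ambient_obtain_vec by blast
    then obtain x where x: "x \<in> errors a b" "vec a b (w - w') = vec a b x"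
      using c by (auto simp: hamming_Gray weight_le_1_iff simp del: One_nat_def)
    then have "vec a b (w - x) = vec a b w'" by (simp add: vec_eq_iff algebra_simps)
    then have 1: "x \<in> errors a b \<and> vec a b (w - x) \<in> C" using x c w' by simp
    show "\<exists>!x. x \<in> errors a b \<and> vec a b (w - x) \<in> C"
    proof (rule ex1I, rule 1)
      fix y assume y: "y \<in> errors a b \<and> vec a b (w - y) \<in> C"
      have "hamming (Gray (vec a b w)) (Gray (vec a b (w - z))) \<le> 1" if "z \<in> errors a b" for z
        using that by (auto simp: hamming_Gray weight_le_1_iff simp del: One_nat_def)
      then have "Gray (vec a b (w - x)) = Gray (vec a b (w - y))" using P 1 y by blast
      then have "vec a b y = vec a b x" unfolding Gray_eq_iff
        by (simp add: vec_eq_iff)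
      then show "y = x" using inj_on_vec_errors 1 y by (auto dest: inj_onD)
    qed
  next
    assume R: "\<forall>w. \<exists>!x. x \<in> errors a b \<and> vec a b (w - x) \<in> C"
    show "z2z4_one_perfect a b C"
      unfolding z2z4_one_perfect_def one_perfect_def
    proof (intro conjI ballI)
      show "Gray ` C \<subseteq> binspace (a + 2 * b)" using amb Gray_in_binspace by blast
      fix z assume "z \<in> binspace (a + 2 * b)"
      then obtain w where w: "z = Gray (vec a b w)" by (rule binspace_obtain_Gray)
      obtain x where x: "x \<in> errors a b" "vec a b (w - x) \<in> C" using R by blast
      show "\<exists>!c. c \<in> Gray ` C \<and> hamming z c \<le> 1"
      proof (rule ex1I[of _ "Gray (vec a b (w - x))"])
        show "Gray (vec a b (w - x)) \<in> Gray ` C \<and> hamming z (Gray (vec a b (w - x))) \<le> 1"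
          using w x by (auto simp: hamming_Gray weight_le_1_iff simp del: One_nat_def)
        fix c assume c: "c \<in> Gray ` C \<and> hamming z c \<le> 1"
        then obtain c' where c': "c = Gray c'" "c' \<in> C" by blast
        then obtain w' where w': "c' = vec a b w'" using amb ambient_obtain_vec by blast
        then obtain y where y: "y \<in> errors a b" "vec a b (w - w') = vec a b y"
          using c c' w by (auto simp: hamming_Gray weight_le_1_iff simp del: One_nat_def)
        then have v: "vec a b (w - y) = vec a b w'" by (simp add: vec_eq_iff algebra_simps)
        then have "y = x" using R x y c' w' by metis
        then show "c = Gray (vec a b (w - x))" using v c' w' by simp
      qed
    qed
  qed
qed

section \<open>Counting in the quotient group\<close>

text \<open>The coset structure of a cyclic perfect code, in an arbitrary abelian group:
  \<open>S\<close> is the subgroup factored out and \<open>T\<close> the shift, which preserves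
  \<open>S\<close> and so acts on classes. \<open>cover\<close> is the existence half of
  perfectness; the assumptions on non-membership and injectivity are the uniqueness half. With
  \<open>i = k\<close>, \<open>q_plus_q\<close> says that \<open>q i\<close> is not its own
  negative, hence has order 4.\<close>

locale cyclic_perfect =
  fixes S :: "'g::ab_group_add set" and e q :: "nat \<Rightarrow> 'g" and T :: "'g \<Rightarrow> 'g" and a b :: nat
  assumes zero_mem: "0 \<in> S"
    and add_mem: "x \<in> S \<Longrightarrow> y \<in> S \<Longrightarrow> x + y \<in> S"
    and uminus_mem: "x \<in> S \<Longrightarrow> - x \<in> S"
    and T_add: "T (x + y) = T x + T y"
    and T_mem: "x \<in> S \<Longrightarrow> T x \<in> S"
    and T_e: "T (e i) = e (Suc i)"
    and T_q: "T (q j) = q (Suc j)"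
    and a_pos: "a > 0" and b_pos: "b > 0"
    and e_periodic: "e (i + a) = e i"
    and q_periodic: "q (j + b) = q j"
    and e_double: "e i + e i \<in> S"
    and q_quadruple: "(q j + q j) + (q j + q j) \<in> S"
    and cover: "x \<in> S \<or> (\<exists>i. x - e i \<in> S) \<or> (\<exists>j. x - q j \<in> S \<or> x + q j \<in> S)"
    and e_notin: "e i \<notin> S"
    and q_notin: "q j \<notin> S"
    and e_inj: "e i - e k \<in> S \<Longrightarrow> i mod a = k mod a"
    and q_inj: "q i - q k \<in> S \<Longrightarrow> i mod b = k mod b"
    and q_plus_q: "q i + q k \<notin> S"
    and e_minus_q: "e i - q k \<notin> S"
begin

section \<open>Congruence modulo S, the shift, and doubling of classes\<close>

definition eqv :: "'g \<Rightarrow> 'g \<Rightarrow> bool"  (infix "\<approx>" 50) where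
  "x \<approx> y \<longleftrightarrow> x - y \<in> S"

lemma diff_mem: "x \<in> S \<Longrightarrow> y \<in> S \<Longrightarrow> x - y \<in> S"
  using add_mem[of x "- y"] uminus_mem[of y] by simp

lemma eqv_refl [simp]: "x \<approx> x"
  by (simp add: eqv_def zero_mem)

lemma eqv_sym: "x \<approx> y \<Longrightarrow> y \<approx> x"
  unfolding eqv_def using uminus_mem by fastforce

lemma eqv_trans [trans]: "x \<approx> y \<Longrightarrow> y \<approx> z \<Longrightarrow> x \<approx> z"
  unfolding eqv_def using add_mem by fastforce

lemma eqv_add: "x \<approx> y \<Longrightarrow> x' \<approx> y' \<Longrightarrow> x + x' \<approx> y + y'"
  unfolding eqv_def using add_mem[of "x - y" "x' - y'"] by (simp add: algebra_simps)

lemma eqv_uminus: "x \<approx> y \<Longrightarrow> - x \<approx> - y"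
  unfolding eqv_def using uminus_mem by fastforce

lemma eqv_mem: "x \<approx> y \<Longrightarrow> y \<in> S \<Longrightarrow> x \<in> S"
  unfolding eqv_def using add_mem by fastforce

lemma T_diff: "T (x - y) = T x - T y"
  using T_add[of "x - y" y] by simp

lemma T_pow_eqv: "x \<approx> y \<Longrightarrow> (T ^^ n) x \<approx> (T ^^ n) y"
  by (induction n) (auto simp: eqv_def T_diff[symmetric] T_mem)

lemma T_pow_add: "(T ^^ n) (x + y) = (T ^^ n) x + (T ^^ n) y"
  by (induction n) (auto simp: T_add)

lemma T_pow_e: "(T ^^ n) (e i) = e (i + n)"
  by (induction n) (auto simp: T_e)

lemma T_pow_q: "(T ^^ n) (q i) = q (i + n)"
  by (induction n) (auto simp: T_q)

lemma q_mod: "q (j mod b) = q j"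
proof -
  have "q (i + m * b) = q i" for i m
    by (induction m) (auto simp: q_periodic add.assoc[symmetric] add.commute[of b])
  from this[of "j mod b" "j div b"] show ?thesis by simp
qed

lemma e_mod: "e (j mod a) = e j"
proof -
  have "e (i + m * a) = e i" for i m
    by (induction m) (auto simp: e_periodic add.assoc[symmetric] add.commute[of a])
  from this[of "j mod a" "j div a"] show ?thesis by simp
qed

lemma q_double_notin: "q j + q j \<notin> S"
  using q_plus_q .

text \<open>By \<open>cover\<close>, the only other possibility is that \<open>x\<close> is
  congruent to some \<open>q j\<close> or its negative, and these have order 4.\<close>

lemma two_torsion:
  assumes "x + x \<in> S"
  shows "x \<in> S \<or> (\<exists>i. x \<approx> e i)"
proof -
  have "\<not> x \<approx> q j" for j
    using eqv_add[of x "q j" x "q j"] assms q_double_notin eqv_mem eqv_sym by blast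
  moreover have "\<not> x + q j \<in> S" for j
  proof
    assume "x + q j \<in> S"
    then have "(x + q j) + (x + q j) - (x + x) \<in> S" using assms add_mem diff_mem by blast
    then show False using q_double_notin[of j] by (simp add: algebra_simps)
  qed
  ultimately show ?thesis using cover[of x] by (auto simp: eqv_def)
qed

lemma order_four:
  assumes "x + x \<notin> S"
  shows "\<exists>j. x \<approx> q j \<or> x + q j \<in> S"
proof -
  have "x \<notin> S" using assms add_mem by blast
  moreover have "\<not> x \<approx> e i" for i
    using eqv_add[of x "e i" x "e i"] assms e_double eqv_mem by blast
  ultimately show ?thesis using cover[of x] by (auto simp: eqv_def)
qed

lemma double_eqv_imp:
  assumes "x + x \<approx> y + y"
  shows "x \<approx> y \<or> (\<exists>i. x \<approx> y + e i)"
  using two_torsion[of "x - y"] assms by (auto simp: eqv_def algebra_simps)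

text \<open>The position of \<open>q 0 + q 0\<close> among the binary classes. Doubling commutes
  with the shift, so this one index determines the doubles of all \<open>q j\<close>.\<close>

definition offset :: nat where
  "offset = (SOME i. q 0 + q 0 \<approx> e i)"

lemma q_double: "q j + q j \<approx> e (offset + j)"
proof -
  have "\<exists>i. q 0 + q 0 \<approx> e i"
    using two_torsion[OF q_quadruple] q_double_notin by blast
  then have "q 0 + q 0 \<approx> e offset" unfolding offset_def by (rule someI_ex)
  then have "(T ^^ j) (q 0 + q 0) \<approx> (T ^^ j) (e offset)" by (rule T_pow_eqv)
  then show ?thesis by (simp add: T_pow_add T_pow_q T_pow_e)
qed

lemma e_eqv_iff: "e i \<approx> e k \<longleftrightarrow> i mod a = k mod a"
  using e_inj e_mod by (metis eqv_def eqv_refl)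

lemma q_eqv_iff: "q i \<approx> q k \<longleftrightarrow> i mod b = k mod b"
  using q_inj q_mod by (metis eqv_def eqv_refl)

lemma q_double_eqv_iff: "q i + q i \<approx> q j + q j \<longleftrightarrow> i mod a = j mod a"
proof -
  have "q i + q i \<approx> q j + q j \<longleftrightarrow> e (offset + i) \<approx> e (offset + j)"
    using q_double eqv_sym eqv_trans by meson
  also have "\<dots> \<longleftrightarrow> i mod a = j mod a"
    unfolding e_eqv_iff by (simp add: nat_mod_eq_iff add.assoc)
  finally show ?thesis .
qed

text \<open>The index \<open>b\<close> gives the same class as 0, hence the same double, and doubles
  determine the index modulo \<open>a\<close>.\<close>

lemma a_dvd_b: "a dvd b"
  using q_double_eqv_iff[of b 0] q_periodic[of 0] by (auto simp: mod_eq_0_iff_dvd)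

lemma q_pm_double:
  assumes "s \<in> {q j, - q j}"
  shows "s + s \<approx> q j + q j"
  using assms
proof (elim insertE emptyE)
  assume "s = - q j"
  then show ?thesis using uminus_mem[OF q_quadruple[of j]] by (simp add: eqv_def algebra_simps)
qed simp

text \<open>The classes $x$ with $2x = 2q_0$ are on the one hand the coset of $q_0$ modulo the
  2-torsion $\{0, e_1, \dots, e_a\}$, on the other hand the classes $\pm q_j$ with $a \mid j$.\<close>

lemma fibre_count: "Suc a = 2 * (b div a)"
proof -
  \<comment> \<open>Indices 0 to \<open>a\<close> enumerate the 2-torsion: 0 is reserved for the
    zero class, so the class \<open>e 0\<close> is reached as \<open>e a\<close>.\<close>
  define \<epsilon> where "\<epsilon> k = (if k = 0 then 0 else e k)" for k
  define \<psi> where "\<psi> = (\<lambda>(s::bool, j). if s then q j else - q j)"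
  define J where "J = {j. j < b \<and> a dvd j}"
  \<comment> \<open>Members of the two lists are matched only up to congruence, so a relation takes
    the place of a bijection. It is total and injective in both directions, which gives the two
    inequalities between the cardinalities.\<close>
  let ?r = "\<lambda>k sj. q 0 + \<epsilon> k \<approx> \<psi> sj"
  have \<epsilon>_inj: "k = l" if "k \<le> a" "l \<le> a" "\<epsilon> k \<approx> \<epsilon> l" for k l
  proof -
    have "k = 0 \<longleftrightarrow> l = 0" using that(3) e_notin[of k] e_notin[of l] uminus_mem[of "- e l"]
      by (auto simp: \<epsilon>_def eqv_def split: if_splits)
    moreover have "k = l" if "k > 0" "l > 0"
    proof -
      have "k mod a = l mod a" using \<open>\<epsilon> k \<approx> \<epsilon> l\<close> that by (simp add: \<epsilon>_def e_eqv_iff)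
      then show ?thesis using \<open>k \<le> a\<close> \<open>l \<le> a\<close> that
        by (metis mod_less mod_self le_neq_implies_less not_less0)
    qed
    ultimately show ?thesis by auto
  qed
  have \<psi>_inj: "x = y" if "x \<in> UNIV \<times> J" "y \<in> UNIV \<times> J" "\<psi> x \<approx> \<psi> y" for x y
  proof -
    obtain s i t j where xy: "x = (s, i)" "y = (t, j)" by (metis surj_pair)
    show ?thesis
      using that xy q_plus_q[of i j] q_plus_q[of j i] uminus_mem[of "- q i - q j"] q_eqv_iff[of i j] eqv_uminus[of "- q i" "- q j"]
      by (auto simp: \<psi>_def J_def eqv_def split: if_splits)
  qed
  have \<psi>_double: "\<psi> (s, j) + \<psi> (s, j) \<approx> q j + q j" for s j
    by (rule q_pm_double) (simp add: \<psi>_def)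
  have \<epsilon>_double: "\<epsilon> k + \<epsilon> k \<in> S" for k
    using e_double zero_mem by (simp add: \<epsilon>_def)
  have \<epsilon>_e: "\<exists>k\<le>a. e i \<approx> \<epsilon> k" for i
  proof (cases "i mod a = 0")
    case True
    then have "e i \<approx> \<epsilon> a" using a_pos by (simp add: \<epsilon>_def e_eqv_iff)
    then show ?thesis by blast
  next
    case False
    then have "e i \<approx> \<epsilon> (i mod a)" by (simp add: \<epsilon>_def e_eqv_iff)
    then show ?thesis using mod_le_divisor[OF a_pos] by blast
  qed
  have ex_\<psi>: "\<exists>sj. sj \<in> UNIV \<times> J \<and> ?r k sj" if "k \<in> {..a}" for k
  proof -
    let ?x = "q 0 + \<epsilon> k"
    have x2: "?x + ?x \<approx> q 0 + q 0" using \<epsilon>_double[of k] by (simp add: eqv_def algebra_simps)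
    then have "?x + ?x \<notin> S" using q_double_notin eqv_mem eqv_sym by blast
    then obtain j where "?x \<approx> q j \<or> ?x + q j \<in> S" using order_four by blast
    then have "?x \<approx> \<psi> (True, j) \<or> ?x \<approx> \<psi> (False, j)" by (simp add: \<psi>_def eqv_def)
    then obtain s where s: "?x \<approx> \<psi> (s, j)" by blast
    have "?x + ?x \<approx> q j + q j" by (rule eqv_trans[OF eqv_add[OF s s] \<psi>_double])
    then have "q 0 + q 0 \<approx> q j + q j" using x2 eqv_sym eqv_trans by blast
    then have "a dvd j" using q_double_eqv_iff[of 0 j] by (auto simp: mod_eq_0_iff_dvd)
    \<comment> \<open>The index found by \<open>order_four\<close> need not lie below
      \<open>b\<close>; reducing it keeps divisibility by \<open>a\<close> because \<open>a\<close>
      divides \<open>b\<close>.\<close>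
    then have "a dvd j mod b" using a_dvd_b by (simp add: dvd_mod_iff)
    then have "j mod b \<in> J" using b_pos by (simp add: J_def)
    moreover have "\<psi> (s, j mod b) = \<psi> (s, j)" by (simp add: \<psi>_def q_mod)
    ultimately show ?thesis using s by (intro exI[of _ "(s, j mod b)"]) simp
  qed
  have ex_\<epsilon>: "\<exists>k. k \<in> {..a} \<and> ?r k sj" if sj: "sj \<in> UNIV \<times> J" for sj
  proof -
    obtain s j where sjd: "sj = (s, j)" "j \<in> J" using sj by auto
    have "q j + q j \<approx> q 0 + q 0" using sjd by (simp add: q_double_eqv_iff J_def mod_eq_0_iff_dvd)
    then have "\<psi> sj + \<psi> sj \<approx> q 0 + q 0"
      unfolding sjd(1) by (rule eqv_trans[OF \<psi>_double])
    then have "\<psi> sj \<approx> q 0 \<or> (\<exists>i. \<psi> sj \<approx> q 0 + e i)" by (rule double_eqv_imp)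
    then show ?thesis
    proof (elim disjE exE)
      assume "\<psi> sj \<approx> q 0"
      then show ?thesis by (intro exI[of _ 0]) (simp add: \<epsilon>_def eqv_sym)
    next
      fix i assume i: "\<psi> sj \<approx> q 0 + e i"
      obtain k where "k \<le> a" "e i \<approx> \<epsilon> k" using \<epsilon>_e by blast
      then show ?thesis using i eqv_add[OF eqv_refl] eqv_sym eqv_trans by (metis atMost_iff)
    qed
  qed
  have uniq_\<epsilon>: "k = l" if "k \<in> {..a}" "l \<in> {..a}" "sj \<in> UNIV \<times> J" "?r k sj" "?r l sj" for k l sj
  proof -
    have "q 0 + \<epsilon> k \<approx> q 0 + \<epsilon> l" using that eqv_sym eqv_trans by blast
    then show ?thesis using \<epsilon>_inj that by (simp add: eqv_def)
  qed
  have uniq_\<psi>: "x = y" if "x \<in> UNIV \<times> J" "y \<in> UNIV \<times> J" "k \<in> {..a}" "?r k x" "?r k y" for k x y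
    using \<psi>_inj[OF that(1,2)] eqv_trans[OF eqv_sym[OF that(4)] that(5)] by blast
  have fin: "finite (UNIV \<times> J :: (bool \<times> nat) set)" by (simp add: J_def)
  have "card {..a} \<le> card (UNIV \<times> J :: (bool \<times> nat) set)"
    by (rule card_le_if_inj_on_rel[where r = ?r, OF fin ex_\<psi> uniq_\<epsilon>])
  moreover have "card (UNIV \<times> J :: (bool \<times> nat) set) \<le> card {..a}"
    by (rule card_le_if_inj_on_rel[where r = "\<lambda>x k. ?r k x", OF finite_atMost ex_\<epsilon> uniq_\<psi>])
  moreover have "card J = b div a"
  proof -
    have "J = (\<lambda>m. m * a) ` {..<b div a}"
      using a_pos a_dvd_b by (auto simp: J_def elim!: dvdE)
    then show ?thesis using a_pos by (simp add: card_image inj_on_def)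
  qed
  ultimately show ?thesis by (simp add: card_cartesian_product)
qed

lemma b_dvd_2a: "b dvd 2 * a"
proof -
  \<comment> \<open>The double of \<open>q j\<close> depends only on \<open>j\<close> modulo
    \<open>a\<close>.\<close>
  have "q a + q a \<approx> q 0 + q 0" by (simp add: q_double_eqv_iff)
  then obtain g where g: "q a \<approx> q 0 + g" "g = 0 \<or> (\<exists>i. g = e i)"
    using double_eqv_imp by (metis add.right_neutral)
  have "(T ^^ a) 0 = 0" using T_pow_add[of a 0 0] by simp
  then have "(T ^^ a) g = g" "g + g \<in> S" using g(2) e_double zero_mem by (auto simp: T_pow_e e_periodic)
  then have "q (a + a) \<approx> q a + g"
    using T_pow_eqv[OF g(1), of a] by (simp add: T_pow_add T_pow_q)
  also have "\<dots> \<approx> q 0 + g + g" by (intro eqv_add g) simp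
  also have "\<dots> \<approx> q 0" using \<open>g + g \<in> S\<close> by (simp add: eqv_def algebra_simps)
  finally show ?thesis by (simp add: q_eqv_iff mult_2 mod_eq_0_iff_dvd)
qed

text \<open>With \<open>b = a * m\<close> the count reads \<open>Suc a = 2 * m\<close>, and
  \<open>b dvd 2 * a\<close> becomes \<open>m dvd 2\<close>; the values 1 and 2 of \<open>m\<close>
  give the two cases.\<close>

lemma parameters: "(a = 1 \<and> b = 1) \<or> (a = 3 \<and> b = 6)"
proof -
  obtain m where m: "b = a * m" using a_dvd_b by blast
  have "Suc a = 2 * m" using fibre_count a_pos m by simp
  moreover have "m dvd 2" using b_dvd_2a a_pos m by (simp add: mult.commute[of 2])
  then have "m \<le> 2" by (simp add: dvd_imp_le)
  ultimately have "m = 1 \<or> m = 2" "Suc a = 2 * m" by linarith+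
  then show ?thesis using m by auto
qed

lemma recurrence:
  assumes "a = 3" "b = 6"
  shows "(\<forall>k. q (k + 2) \<approx> q k + q (k + 1)) \<or> (\<forall>k. q (k + 2) \<approx> q k - q (k + 1))"
proof -
  have shift: "q (k + 2) \<approx> f k" if "q 2 \<approx> f 0" "\<And>k. (T ^^ k) (f 0) = f k" for f k
    using T_pow_eqv[OF that(1), of k] that(2)[of k] by (simp add: T_pow_q add.commute)
  have residue: "\<exists>d<3. e k \<approx> e (i + d)" for i k
  proof -
    \<comment> \<open>The witness is \<open>k - i\<close> modulo 3, with \<open>2 * i\<close> in
      place of \<open>- i\<close> to stay in the naturals.\<close>
    have "(i + (k + 2 * i) mod 3) mod 3 = (i + (k + 2 * i)) mod 3" by (rule mod_add_right_eq)
    also have "\<dots> = k mod 3" by presburger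
    finally have "e k \<approx> e (i + (k + 2 * i) mod 3)" by (simp add: e_eqv_iff assms)
    then show ?thesis by (intro exI[of _ "(k + 2 * i) mod 3"]) simp
  qed
  \<comment> \<open>In a Klein four-group the sum of two distinct nonzero elements is the
    third.\<close>
  have e3: "e i + e (i + 1) \<approx> e (i + 2)" for i
  proof -
    let ?x = "e i + e (i + 1)"
    have "?x + ?x \<in> S" using add_mem[OF e_double[of i] e_double[of "i+1"]] by (simp add: algebra_simps)
    then have "?x \<in> S \<or> (\<exists>k. ?x \<approx> e k)" by (rule two_torsion)
    moreover have "?x \<notin> S"
    proof
      assume "?x \<in> S"
      then have "e i \<approx> e (i + 1)"
        using diff_mem[OF \<open>?x \<in> S\<close> e_double[of "i + 1"]] by (simp add: eqv_def algebra_simps)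
      then show False by (simp add: e_eqv_iff assms) presburger
    qed
    ultimately obtain k where "?x \<approx> e k" by blast
    moreover obtain d where "d < 3" "e k \<approx> e (i + d)" using residue by blast
    ultimately have d: "?x \<approx> e (i + d)" using eqv_trans by blast
    have "d \<noteq> 0"
    proof
      assume "d = 0"
      with d show False using e_notin[of "i + 1"] by (simp add: eqv_def)
    qed
    moreover have "d \<noteq> 1"
    proof
      assume "d = 1"
      with d show False using e_notin[of i] by (simp add: eqv_def)
    qed
    ultimately have "d = 2" using \<open>d < 3\<close> by simp
    then show ?thesis using d by simp
  qed
  have "(q 0 + q 1) + (q 0 + q 1) = (q 0 + q 0) + (q 1 + q 1)" by (simp add: algebra_simps)
  also have "\<dots> \<approx> e offset + e (offset + 1)"
    using eqv_add[OF q_double[of 0] q_double[of 1]] by simp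
  also have "\<dots> \<approx> e (offset + 2)" by (rule e3)
  also have "\<dots> \<approx> q 2 + q 2" using q_double eqv_sym by blast
  finally have "q 2 + q 2 \<approx> (q 0 + q 1) + (q 0 + q 1)" by (rule eqv_sym)
  then have "q 2 \<approx> q 0 + q 1 \<or> (\<exists>i. q 2 \<approx> q 0 + q 1 + e i)" by (rule double_eqv_imp)
  then consider "q 2 \<approx> q 0 + q 1" | i where "q 2 \<approx> q 0 + q 1 + e i" by blast
  then have four: "q 2 \<approx> q 0 + q 1 \<or> q 2 \<approx> q 0 - q 1 \<or> q 2 \<approx> - q 0 + q 1 \<or> q 2 \<approx> - q 0 - q 1"
  proof cases
    case 2
    \<comment> \<open>Each 2-torsion class is the double of one of \<open>q 0\<close>,
      \<open>q 1\<close>, \<open>q 2\<close>. For \<open>k = 0\<close> or \<open>k = 1\<close>,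
      subtracting four times \<open>q k\<close> flips the sign of that summand; for
      \<open>k = 2\<close>, moving \<open>q 2 + q 2\<close> to the other side flips both
      signs.\<close>
    obtain k where k: "k < 3" "e i \<approx> e (offset + k)" using residue by blast
    then have ek: "e i \<approx> q k + q k" using q_double eqv_sym eqv_trans by blast
    have *: "q 2 \<approx> q 0 + q 1 + (q k + q k)"
      using 2 eqv_add[OF eqv_refl ek] eqv_trans by blast
    consider "k = 0" | "k = 1" | "k = 2" using k by linarith
    then show ?thesis
    proof cases
      case 1
      have "q 2 \<approx> - q 0 + q 1"
        using add_mem[OF *[unfolded eqv_def] q_quadruple[of 0]] 1 by (simp add: eqv_def algebra_simps)
      then show ?thesis by simp
    next
      case 2
      have "q 2 \<approx> q 0 - q 1"
        using add_mem[OF *[unfolded eqv_def] q_quadruple[of 1]] 2 by (simp add: eqv_def algebra_simps)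
      then show ?thesis by simp
    next
      case 3
      have "q 2 \<approx> - q 0 - q 1"
        using uminus_mem[OF *[unfolded eqv_def]] 3 by (simp add: eqv_def algebra_simps)
      then show ?thesis by simp
    qed
  qed simp
  have T_pow_uminus: "(T ^^ k) (- x) = - (T ^^ k) x" for k x
    by (induction k) (use T_diff[of 0] T_add[of 0 0] in \<open>simp_all add: minus_unique\<close>)
  have T_pow_diff: "(T ^^ k) (x - y) = (T ^^ k) x - (T ^^ k) y" for k x y
    using T_pow_add[of k x "- y"] T_pow_uminus by simp
  note T_simps = T_pow_uminus T_pow_diff T_pow_add T_pow_q
  from four show ?thesis
  proof (elim disjE)
    assume "q 2 \<approx> q 0 + q 1"
    then show ?thesis using shift[of "\<lambda>k. q k + q (k + 1)"] by (simp add: T_simps)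
  next
    assume "q 2 \<approx> q 0 - q 1"
    then show ?thesis using shift[of "\<lambda>k. q k - q (k + 1)"] by (simp add: T_simps)
  next
    assume "q 2 \<approx> - q 0 + q 1"
    then have r: "q (k + 2) \<approx> - q k + q (k + 1)" for k
      using shift[of "\<lambda>k. - q k + q (k + 1)" k] by (simp add: T_simps)
    \<comment> \<open>The relations at 0 and 1 telescope: \<open>q 2\<close> and \<open>q 1\<close>
      cancel in their sum.\<close>
    have "q 3 + q 0 \<in> S"
      using add_mem[OF r[of 0, unfolded eqv_def] r[of 1, unfolded eqv_def]]
      by (simp add: algebra_simps eval_nat_numeral)
    then show ?thesis using q_plus_q by blast
  next
    assume "q 2 \<approx> - q 0 - q 1"
    then have r: "q (k + 2) \<approx> - q k - q (k + 1)" for k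
      using shift[of "\<lambda>k. - q k - q (k + 1)" k] by (simp add: T_simps)
    have "q 3 \<approx> q 0"
      using diff_mem[OF r[of 1, unfolded eqv_def] r[of 0, unfolded eqv_def]]
      by (simp add: algebra_simps eval_nat_numeral eqv_def)
    then show ?thesis using assms by (simp add: q_eqv_iff)
  qed
qed

end

section \<open>The quotient of a cyclic perfect code\<close>

text \<open>The predecessor index is written \<open>k + a - 1\<close> so that natural subtraction
  does not truncate at \<open>k = 0\<close>.\<close>

definition shift :: "nat \<Rightarrow> nat \<Rightarrow> lift \<Rightarrow> lift" where
  "shift a b w = (\<lambda>k. fst w ((k + a - 1) mod a), \<lambda>k. snd w ((k + b - 1) mod b))"

lemma cshift_map: "cshift (map f [0..<n]) = map (\<lambda>k. f ((k + n - 1) mod n)) [0..<n]"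
proof (cases n)
  case (Suc m)
  have "cshift (map f [0..<n]) ! k = f ((k + n - 1) mod n)" if "k < n" for k
    using that Suc by (cases k) (auto simp: cshift_def nth_append nth_Cons butlast_append mod_if)
  moreover have "length (cshift (map f [0..<n])) = n" by (simp add: cshift_def)
  ultimately show ?thesis by (simp add: list_eq_iff_nth_eq)
qed (simp add: cshift_def)

lemma vec_shift: "vec a b (shift a b w) = (cshift (fst (vec a b w)), cshift (snd (vec a b w)))"
  by (simp add: vec_def cshift_map shift_def)

lemma pred_mod_eq_iff: "n > 0 \<Longrightarrow> (k + n - Suc 0) mod n = i mod n \<longleftrightarrow> k mod n = Suc i mod n" for n :: nat
proof -
  assume n: "n > 0"
  have "(k + n - Suc 0) mod n = i mod n \<longleftrightarrow> Suc (k + n - Suc 0) mod n = Suc i mod n"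
    by (simp add: nat_mod_eq_iff)
  then show ?thesis using n by simp
qed

lemma shift_bin_unit: "a > 0 \<Longrightarrow> shift a b (bin_unit a i) = bin_unit a (Suc i)"
  by (simp add: shift_def bin_unit_def pred_mod_eq_iff zero_fun_def)

lemma shift_quat_unit: "b > 0 \<Longrightarrow> shift a b (quat_unit b i) = quat_unit b (Suc i)"
  by (simp add: shift_def quat_unit_def pred_mod_eq_iff zero_fun_def)

lemma shift_add: "shift a b (w + w') = shift a b w + shift a b w'"
  by (simp add: shift_def plus_fun_def)

lemma bin_unit_mod: "bin_unit a (i mod a) = bin_unit a i"
  by (simp add: bin_unit_def)

lemma quat_unit_mod: "quat_unit b (i mod b) = quat_unit b i"
  by (simp add: quat_unit_def)

lemma bin_unit_in_errors: "a > 0 \<Longrightarrow> bin_unit a i \<in> errors a b"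
  using bin_unit_mod[of a i] by (auto simp: errors_def image_iff) (metis mod_less_divisor lessThan_iff)

lemma quat_unit_in_errors:
  assumes "b > 0"
  shows "quat_unit b i \<in> errors a b" "- quat_unit b i \<in> errors a b"
  using assms quat_unit_mod[of b i] by (auto simp: errors_def image_iff) (metis mod_less_divisor lessThan_iff)+

lemma bin_unit_eq_iff: "bin_unit a i = bin_unit a k \<longleftrightarrow> i mod a = k mod a"
  by (auto simp: bin_unit_def fun_eq_iff)

lemma quat_unit_eq_iff: "quat_unit b i = quat_unit b k \<longleftrightarrow> i mod b = k mod b"
  by (auto simp: quat_unit_def fun_eq_iff)

text \<open>All distinctness assumptions of the locale have one source: different errors lie in
  different cosets (\<open>dist\<close>). So it is enough to tell the units apart as functions
  (\<open>ne\<close>).\<close>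

lemma cyclic_perfect_instance:
  assumes C: "additive_code a b C" and P: "z2z4_one_perfect a b C" and cyc: "z2z4_cyclic C"
    and pos: "a > 0" "b > 0"
  shows "cyclic_perfect {w. vec a b w \<in> C} (bin_unit a) (quat_unit b) (shift a b) a b"
proof -
  let ?S = "{w. vec a b w \<in> C}"
  have uniq: "\<exists>!x. x \<in> errors a b \<and> w - x \<in> ?S" for w
    using P unfolding one_perfect_iff[OF C] mem_Collect_eq by (rule spec)
  have zero: "0 \<in> ?S" using C by (simp add: vec_zero additive_code_def)
  \<comment> \<open>Both \<open>x\<close> and \<open>y\<close> are errors that take \<open>x\<close>
    into \<open>S\<close>, the former because \<open>x - x\<close> is 0.\<close>
  have dist: "x = y" if "x \<in> errors a b" "y \<in> errors a b" "x - y \<in> ?S" for x y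
    using uniq[of x] that zero by (metis diff_self)
  have zero_err: "0 \<in> errors a b" by (simp add: errors_def)
  note errs = zero_err bin_unit_in_errors[OF pos(1)] quat_unit_in_errors[OF pos(2)]
  have ker: "w \<in> ?S" if "vec a b w = vec a b 0" for w using that zero by simp
  have ne: "bin_unit a i \<noteq> 0" "quat_unit b i \<noteq> 0" "quat_unit b i \<noteq> - quat_unit b k"
    "bin_unit a i \<noteq> quat_unit b k" for i k
  proof -
    have fi: "fst (bin_unit a i) i = 1" and si: "snd (quat_unit b i) i = 1"
      by (simp_all add: bin_unit_def quat_unit_def)
    from fi show "bin_unit a i \<noteq> 0" by auto
    from si show "quat_unit b i \<noteq> 0" by auto
    have "- snd (quat_unit b k) i \<noteq> 1" "fst (quat_unit b k) i \<noteq> 1"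
      by (simp_all add: quat_unit_def)
    with fi si show "quat_unit b i \<noteq> - quat_unit b k" "bin_unit a i \<noteq> quat_unit b k"
      by (metis snd_uminus uminus_apply, metis)
  qed
  show ?thesis
  proof
    fix x y assume "x \<in> ?S" "y \<in> ?S"
    then show "x + y \<in> ?S" using C by (simp add: vec_add additive_code_def)
  next
    fix x assume "x \<in> ?S"
    then show "- x \<in> ?S" "shift a b x \<in> ?S"
      using C cyc by (simp_all add: vec_uminus vec_shift additive_code_def z2z4_cyclic_def)
  next
    fix x
    obtain y where y: "y \<in> errors a b" "x - y \<in> ?S" using uniq by blast
    then show "x \<in> ?S \<or> (\<exists>i. x - bin_unit a i \<in> ?S) \<or>
        (\<exists>j. x - quat_unit b j \<in> ?S \<or> x + quat_unit b j \<in> ?S)"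
      unfolding errors_def by fastforce
  next
    fix i show "bin_unit a i + bin_unit a i \<in> ?S"
      by (rule ker) (auto simp: vec_eq_iff bin_unit_def)
  next
    fix j show "quat_unit b j + quat_unit b j + (quat_unit b j + quat_unit b j) \<in> ?S"
      by (rule ker) (auto simp: vec_eq_iff quat_unit_def)
  next
    fix i show "bin_unit a i \<notin> ?S" using dist[OF errs(2) errs(1), of i] ne by auto
  next
    fix i show "quat_unit b i \<notin> ?S" using dist[OF errs(3) errs(1), of i] ne by auto
  next
    fix i k assume "bin_unit a i - bin_unit a k \<in> ?S"
    then show "i mod a = k mod a" using dist[OF errs(2) errs(2)] bin_unit_eq_iff by blast
  next
    fix i k assume "quat_unit b i - quat_unit b k \<in> ?S"
    then show "i mod b = k mod b" using dist[OF errs(3) errs(3)] quat_unit_eq_iff by blast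
  next
    fix i k show "quat_unit b i + quat_unit b k \<notin> ?S"
      using dist[OF errs(3) errs(4), of i k] ne by auto
  next
    fix i k show "bin_unit a i - quat_unit b k \<notin> ?S"
      using dist[OF errs(2) errs(3), of i k] ne by auto
  next
    fix i show "bin_unit a (i + a) = bin_unit a i" "quat_unit b (i + b) = quat_unit b i"
      by (simp_all add: bin_unit_def quat_unit_def)
  qed (use pos zero in \<open>simp_all add: shift_add shift_bin_unit shift_quat_unit\<close>)
qed

text \<open>Without quaternary coordinates the Gray map only forgets an empty list, so it is
  additive. Nonlinearity thus forces \<open>b\<close> to be positive.\<close>

lemma binary_linear_no_quaternary:
  assumes C: "additive_code a 0 C"
  shows "binary_linear (a + 2 * 0) (Gray ` C)"
proof -
  have sub: "C \<subseteq> ambient a 0" using C by (simp add: additive_code_def)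
  have "Gray (vadd x y) = map2 (\<lambda>a b. (a + b) mod 2) (Gray x) (Gray y)" if "x \<in> C" "y \<in> C" for x y
  proof -
    have "snd x = []" "snd y = []" using that sub by (auto simp: ambient_def)
    then show ?thesis by (simp add: Gray_def vadd_def)
  qed
  then have "map2 (\<lambda>a b. (a + b) mod 2) (Gray x) (Gray y) \<in> Gray ` C" if "x \<in> C" "y \<in> C" for x y
    using that C unfolding additive_code_def by (metis imageI)
  moreover have "replicate a 0 \<in> Gray ` C"
    using C by (auto simp: additive_code_def vzero_def Gray_def image_iff intro!: bexI[of _ "vzero a 0"])
  ultimately show ?thesis
    using sub Gray_in_binspace[of _ a 0] by (auto simp: binary_linear_def)
qed

text \<open>Six of the eight vectors represent nonzero classes: the binary unit \<open>e\<close>,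
  the elements \<open>q\<close>, \<open>- q\<close> and \<open>q + q\<close>, and the two sums of
  \<open>e\<close> with \<open>q\<close> and \<open>- q\<close>. Only (0|0) and (1|2) can remain;
  their Gray images are 000 and 111.\<close>

lemma binary_linear_1_1:
  assumes C: "additive_code 1 1 C"
    and cp: "cyclic_perfect {w. vec 1 1 w \<in> C} (bin_unit 1) (quat_unit 1) (shift 1 1) 1 1"
  shows "binary_linear (1 + 2 * 1) (Gray ` C)"
proof -
  interpret cyclic_perfect "{w. vec 1 1 w \<in> C}" "bin_unit 1" "quat_unit 1" "shift 1 1" 1 1
    by (fact cp)
  have "bin_unit 1 0 + quat_unit 1 0 \<notin> {w. vec 1 1 w \<in> C}"
  proof
    assume h: "bin_unit 1 0 + quat_unit 1 0 \<in> {w. vec 1 1 w \<in> C}"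
    show False
      using diff_mem[OF e_double[of 0] h] e_minus_q[of 0 0] by (simp add: algebra_simps)
  qed
  then have no: "([0], [1]) \<notin> C" "([0], [2]) \<notin> C" "([0], [3]) \<notin> C" "([1], [0]) \<notin> C"
    "([1], [1]) \<notin> C" "([1], [3]) \<notin> C"
    using q_notin[of 0] q_double_notin[of 0] uminus_mem[of "- quat_unit 1 0"] e_notin[of 0] e_minus_q[of 0 0]
    by (auto simp: vec_def bin_unit_def quat_unit_def)
  have "C \<subseteq> {([0], [0]), ([1], [2])}"
  proof
    fix x assume x: "x \<in> C"
    then have "x \<in> ambient 1 1" using C by (auto simp: additive_code_def)
    then obtain s t where st: "x = ([s], [t])" "s \<in> {0, 1}" "t \<in> {0, 1, 2, 3}"
      by (auto simp: ambient_def length_Suc_conv)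
    then show "x \<in> {([0], [0]), ([1], [2])}" using no x by auto
  qed
  moreover have "([0], [0]) \<in> C" using C by (auto simp: additive_code_def vzero_def)
  ultimately have "C = {([0], [0])} \<or> C = {([0], [0]), ([1], [2])}" by auto
  then show ?thesis
    by (auto simp: binary_linear_def binspace_def Gray_def gray_def eval_nat_numeral)
qed

section \<open>Integer multiples of lifts and the parity checks of Cstar\<close>

definition scale :: "int \<Rightarrow> lift \<Rightarrow> lift" where
  "scale k w = (\<lambda>i. k * fst w i, \<lambda>j. k * snd w j)"

lemma scale_add_left: "scale (k + l) w = scale k w + scale l w"
  by (simp add: scale_def plus_fun_def algebra_simps)

lemma scale_diff_left: "scale (k - l) w = scale k w - scale l w"
  by (simp add: scale_def fun_diff_def algebra_simps)

lemma scale_add_right: "scale k (w + w') = scale k w + scale k w'"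
  by (simp add: scale_def plus_fun_def algebra_simps)

lemma scale_diff_right: "scale k (w - w') = scale k w - scale k w'"
  by (simp add: scale_def fun_diff_def algebra_simps)

lemma scale_0 [simp]: "scale 0 w = 0" and scale_1 [simp]: "scale 1 w = w"
  by (simp_all add: scale_def zero_fun_def zero_prod_def)

lemma scale_scale: "scale k (scale l w) = scale (k * l) w"
  by (simp add: scale_def algebra_simps)

lemma scale_mem:
  assumes S: "0 \<in> S" "\<And>x y. x \<in> S \<Longrightarrow> y \<in> S \<Longrightarrow> x + y \<in> S" "\<And>x. x \<in> S \<Longrightarrow> - x \<in> S"
    and w: "w \<in> S"
  shows "scale k w \<in> S"
proof (induction k rule: int_induct[where k = 0])
  case base then show ?case using S by simp
next
  case (step1 i) then show ?case using S w by (simp add: scale_add_left)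
next
  case (step2 i) then show ?case using S(2)[OF step2(2) S(3)[OF w]] by (simp add: scale_diff_left)
qed

text \<open>The inner product with \<open>h1\<close> on integer lifts, not yet reduced modulo 4, so
  that it is additive on the nose.\<close>

definition check1 :: "lift \<Rightarrow> int" where
  "check1 w = 2 * (fst w 0 + fst w 1) + snd w 0 + snd w 1 + 2 * snd w 2 + 3 * snd w 3 + snd w 4"

definition check2 :: "lift \<Rightarrow> int" where
  "check2 w = 2 * (fst w 1 + fst w 2) + snd w 1 + snd w 2 + 2 * snd w 3 + 3 * snd w 4 + snd w 5"

lemmas check_defs = check1_def check2_def

lemma check_linear:
  "check1 0 = 0" "check1 (w + w') = check1 w + check1 w'" "check1 (w - w') = check1 w - check1 w'"
  "check1 (- w) = - check1 w"
  "check2 0 = 0" "check2 (w + w') = check2 w + check2 w'" "check2 (w - w') = check2 w - check2 w'"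
  "check2 (- w) = - check2 w"
  by (simp_all add: check_defs algebra_simps)

text \<open>\<open>ip\<close> sees reduced entries, the checks unreduced ones. The difference is a
  multiple of 4, also for the binary entries, which are reduced modulo 2 but weighted by 2; the
  instances of \<open>k\<close> collect the quotients.\<close>

lemma vec_Cstar_iff: "vec 3 6 w \<in> Cstar \<longleftrightarrow> 4 dvd check1 w \<and> 4 dvd check2 w"
proof -
  have e: "[0..<3] = [0, 1, 2]" "[0..<6] = [0, 1, 2, 3, 4, 5]"
    by (simp_all add: upt_rec)
  have s: "{..<3} = {0, 1, 2::nat}" "{..<6} = {0, 1, 2, 3, 4, 5::nat}" by auto
  have n: "int (nat (x mod 2)) = x mod 2" "int (nat (x mod 4)) = x mod 4" for x :: int by simp_all
  have z: "x mod 4 = 0 \<longleftrightarrow> 4 dvd int x" for x :: nat by presburger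
  have dvd_shift: "4 dvd x \<longleftrightarrow> 4 dvd y" if "x = y - 4 * k" for x y k :: int
    using that by (simp add: dvd_diff_left_iff)
  have m: "x mod 2 = x - 2 * (x div 2)" "x mod 4 = x - 4 * (x div 4)" for x :: int
    by (simp_all add: minus_mult_div_eq_mod)
  have "ip h1 (vec 3 6 w) = 0 \<longleftrightarrow> 4 dvd check1 w"
    unfolding ip_def h1_def vec_def e fst_conv snd_conv list.map z
    by (rule dvd_shift[where k = "fst w 0 div 2 + fst w 1 div 2 + snd w 0 div 4 + snd w 1 div 4 +
      2 * (snd w 2 div 4) + 3 * (snd w 3 div 4) + snd w 4 div 4"],
      simp add: s eval_nat_numeral n check_defs, simp only: m, simp)
  moreover have "ip h2 (vec 3 6 w) = 0 \<longleftrightarrow> 4 dvd check2 w"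
    unfolding ip_def h2_def vec_def e fst_conv snd_conv list.map z
    by (rule dvd_shift[where k = "fst w 1 div 2 + fst w 2 div 2 + snd w 1 div 4 + snd w 2 div 4 +
      2 * (snd w 3 div 4) + 3 * (snd w 4 div 4) + snd w 5 div 4"],
      simp add: s eval_nat_numeral n check_defs, simp only: m, simp)
  ultimately show ?thesis using vec_in_ambient by (simp add: Cstar_def)
qed

section \<open>Properties of Cstar and invariance of the type\<close>

lemma permute_list_by_map:
  assumes "p permutes {0..<n}"
  shows "permute_list_by p (map f [0..<n]) = map (f \<circ> p) [0..<n]"
  using permutes_in_image[OF assms] by (auto simp: permute_list_by_def list_eq_iff_nth_eq)

lemma permute_list_by_replicate:
  assumes "p permutes {0..<n}"
  shows "permute_list_by p (replicate n x) = replicate n x"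
proof (rule nth_equalityI)
  fix i assume "i < length (permute_list_by p (replicate n x))"
  then have i: "i < n" by (simp add: permute_list_by_def)
  then have "p i < n" using permutes_in_image[OF assms, of i] by simp
  with i show "permute_list_by p (replicate n x) ! i = replicate n x ! i"
    by (simp add: permute_list_by_def)
qed (simp add: permute_list_by_def)

lemma inj_on_permute_list_by:
  assumes "p permutes {0..<n}"
  shows "inj_on (permute_list_by p) {xs. length xs = n}"
proof (rule inj_onI)
  fix xs ys :: "'a list"
  assume l: "xs \<in> {xs. length xs = n}" "ys \<in> {xs. length xs = n}"
    and e: "permute_list_by p xs = permute_list_by p ys"
  have "xs ! k = ys ! k" if k: "k < n" for k
  proof -
    obtain i where i: "i < n" "p i = k" using k permutes_image[OF assms] by (metis atLeastLessThan_iff imageE zero_le)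
    have "permute_list_by p xs ! i = xs ! k" "permute_list_by p ys ! i = ys ! k"
      using i l by (simp_all add: permute_list_by_def)
    then show ?thesis using e by simp
  qed
  then show "xs = ys" using l by (simp add: list_eq_iff_nth_eq)
qed

lemma permute_list_by_map2:
  assumes "p permutes {0..<n}" "length xs = n" "length ys = n"
  shows "permute_list_by p (map2 f xs ys) = map2 f (permute_list_by p xs) (permute_list_by p ys)"
  using assms permutes_in_image[OF assms(1)] by (auto simp: permute_list_by_def list_eq_iff_nth_eq)

text \<open>Permuting coordinates within each part is an additive bijection that fixes zero and
  commutes with projection to the binary part. It therefore transports the group isomorphism and the
  data behind kappa.\<close>

lemma has_type_perm_equiv:
  assumes eq: "perm_equiv a b C D" and D: "has_type D a b g d k" and C: "additive_code a b C"
  shows "has_type C a b g d k"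
proof -
  obtain p r where p: "p permutes {0..<a}" and r: "r permutes {0..<b}"
    and CD: "C = (\<lambda>x. (permute_list_by p (fst x), permute_list_by r (snd x))) ` D"
    using eq unfolding perm_equiv_def by blast
  define P where "P = (\<lambda>x::z2z4vec. (permute_list_by p (fst x), permute_list_by r (snd x)))"
  have CP: "C = P ` D" using CD by (simp add: P_def)
  have Dadd: "additive_code a b D" using D by (simp add: has_type_def)
  then have len: "length (fst x) = a" "length (snd x) = b" if "x \<in> D" for x
    using that by (auto simp: additive_code_def ambient_def)
  have Pinj: "x = y" if "length (fst x) = a" "length (snd x) = b" "length (fst y) = a" "length (snd y) = b"
    "P x = P y" for x y
    using inj_onD[OF inj_on_permute_list_by[OF p], of "fst x" "fst y"]
      inj_onD[OF inj_on_permute_list_by[OF r], of "snd x" "snd y"] that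
    by (simp add: P_def prod_eq_iff)
  have Pinj_on: "inj_on P D" by (rule inj_onI) (use Pinj len in blast)
  have Padd: "P (vadd x y) = vadd (P x) (P y)" if "x \<in> D" "y \<in> D" for x y
    using len that by (simp add: P_def vadd_def permute_list_by_map2[OF p] permute_list_by_map2[OF r])
  have P0: "P (vzero a b) = vzero a b"
    by (simp add: P_def vzero_def permute_list_by_replicate[OF p] permute_list_by_replicate[OF r])
  have Dclosed: "vadd x y \<in> D" if "x \<in> D" "y \<in> D" for x y
    using Dadd that by (simp add: additive_code_def)
  obtain f where f: "bij_betw f D (ambient g d)" "\<forall>x\<in>D. \<forall>y\<in>D. f (vadd x y) = vadd (f x) (f y)"
    using D by (auto simp: has_type_def group_iso_type_def)
  define h where "h = f \<circ> inv_into D P"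
  have hP: "h (P x) = f x" if "x \<in> D" for x
    using that Pinj_on by (simp add: h_def)
  have "bij_betw h C (ambient g d)"
    unfolding h_def CP using Pinj_on f(1)
    by (intro bij_betw_trans[OF bij_betw_inv_into]) (auto simp: bij_betw_def)
  moreover have "h (vadd x y) = vadd (h x) (h y)" if "x \<in> C" "y \<in> C" for x y
    using that f(2) unfolding CP by (auto simp: Padd[symmetric] hP Dclosed)
  ultimately have "group_iso_type C g d" unfolding group_iso_type_def by blast
  moreover have "card (fst ` Cb a b C) = 2 ^ k"
  proof -
    have "vadd (P x) (P x) = vzero a b \<longleftrightarrow> vadd x x = vzero a b" if "x \<in> D" for x
    proof -
      have "vadd (P x) (P x) = vzero a b \<longleftrightarrow> P (vadd x x) = P (vzero a b)"
        using that by (simp add: Padd P0)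
      also have "\<dots> \<longleftrightarrow> vadd x x = vzero a b"
        using Pinj[of "vadd x x" "vzero a b"] len[OF Dclosed[OF that that]] by (auto simp: vzero_def)
      finally show ?thesis .
    qed
    then have "Cb a b C = P ` Cb a b D" unfolding Cb_def CP by auto
    then have "fst ` Cb a b C = permute_list_by p ` fst ` Cb a b D"
      by (simp add: image_image P_def)
    moreover have "fst ` Cb a b D \<subseteq> {xs. length xs = a}" using len by (auto simp: Cb_def)
    ultimately show ?thesis
      using D card_image[OF inj_on_subset[OF inj_on_permute_list_by[OF p]]] by (metis has_type_def)
  qed
  ultimately show ?thesis using C by (simp add: has_type_def)
qed

section \<open>Cstar is additive, cyclic, perfect and of the stated type\<close>

lemma additive_code_Cstar: "additive_code 3 6 Cstar"
  unfolding additive_code_def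
proof (intro conjI ballI)
  show amb: "Cstar \<subseteq> ambient 3 6" by (auto simp: Cstar_def)
  show "vzero 3 6 \<in> Cstar" unfolding vec_zero[symmetric] vec_Cstar_iff check_linear by simp
  fix x assume x: "x \<in> Cstar"
  then obtain w where w: "x = vec 3 6 w" using amb ambient_obtain_vec by blast
  show "vneg x \<in> Cstar" using x unfolding w vec_uminus[symmetric] vec_Cstar_iff check_linear
    by simp
  fix y assume y: "y \<in> Cstar"
  then obtain w' where w': "y = vec 3 6 w'" using amb ambient_obtain_vec by blast
  show "vadd x y \<in> Cstar" using x y unfolding w w' vec_add[symmetric] vec_Cstar_iff check_linear
    by simp
qed

text \<open>Modulo 4 the shift sends the pair of checks (s, t) to (s + t, s), the Fibonacci step, so
  it preserves their common kernel.\<close>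

lemma z2z4_cyclic_Cstar: "z2z4_cyclic Cstar"
  unfolding z2z4_cyclic_def
proof
  fix x assume x: "x \<in> Cstar"
  then obtain w where w: "x = vec 3 6 w"
    using additive_code_Cstar ambient_obtain_vec unfolding additive_code_def by blast
  have "check1 (shift 3 6 w) = check1 w + check2 w - 4 * (fst w 1 + snd w 3 + snd w 4)"
    "check2 (shift 3 6 w) = check1 w"
    by (simp_all add: check_defs shift_def) (simp add: numeral_2_eq_2)
  then show "(cshift (fst x), cshift (snd x)) \<in> Cstar"
    using x unfolding w vec_shift[symmetric] vec_Cstar_iff by (simp add: dvd_diff)
qed

text \<open>Coordinates on the quotient by \<open>Cstar\<close>: congruence classes correspond to
  pairs of residues modulo 4.\<close>

definition syndrome :: "lift \<Rightarrow> int \<times> int" where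
  "syndrome w = (check1 w mod 4, check2 w mod 4)"

lemma vec_diff_Cstar_iff: "vec 3 6 (w - x) \<in> Cstar \<longleftrightarrow> syndrome w = syndrome x"
  unfolding vec_Cstar_iff syndrome_def prod.inject mod_eq_dvd_iff check_linear ..

text \<open>There are at most 1 + 3 + 6 + 6 = 16 errors and they hit all 16 syndromes. Counting then
  gives injectivity, so no pairwise comparison of errors is made.\<close>

lemma z2z4_one_perfect_Cstar: "z2z4_one_perfect 3 6 Cstar"
proof -
  have l: "{..<3} = {0, 1, 2::nat}" "{..<6} = {0, 1, 2, 3, 4, 5::nat}" by auto
  have im: "syndrome ` errors 3 6 = {0, 1, 2, 3} \<times> {0, 1, 2, 3}"
  proof -
    have "syndrome 0 = (0, 0)"
      by (simp add: syndrome_def check_defs)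
    moreover have "syndrome (bin_unit 3 0) = (2, 0)" "syndrome (bin_unit 3 1) = (2, 2)"
      "syndrome (bin_unit 3 2) = (0, 2)"
      by (simp_all add: syndrome_def check_defs bin_unit_def)
    moreover have "syndrome (quat_unit 6 0) = (1, 0)" "syndrome (quat_unit 6 1) = (1, 1)"
      "syndrome (quat_unit 6 2) = (2, 1)" "syndrome (quat_unit 6 3) = (3, 2)"
      "syndrome (quat_unit 6 4) = (1, 3)" "syndrome (quat_unit 6 5) = (0, 1)"
      by (simp_all add: syndrome_def check_defs quat_unit_def)
    moreover have "syndrome (- quat_unit 6 0) = (3, 0)" "syndrome (- quat_unit 6 1) = (3, 3)"
      "syndrome (- quat_unit 6 2) = (2, 3)" "syndrome (- quat_unit 6 3) = (1, 2)"
      "syndrome (- quat_unit 6 4) = (3, 1)" "syndrome (- quat_unit 6 5) = (0, 3)"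
      by (simp_all add: syndrome_def check_defs quat_unit_def)
    ultimately have "syndrome ` errors 3 6 = {(0,0), (2,0), (2,2), (0,2), (1,0), (1,1), (2,1), (3,2), (1,3), (0,1),
        (3,0), (3,3), (2,3), (1,2), (3,1), (0,3)}"
      unfolding errors_def l image_Un image_insert image_empty by (simp only: Un_insert_left Un_empty_left)
    also have "\<dots> = {0, 1, 2, 3} \<times> {0, 1, 2, 3}"
      by auto
    finally show ?thesis .
  qed
  have "card (errors 3 6) \<le> 16"
  proof -
    have "card (errors 3 6) \<le> card {0::lift} + card (bin_unit 3 ` {..<3}) + card (quat_unit 6 ` {..<6})
        + card ((\<lambda>j. - quat_unit 6 j) ` {..<6})"
      unfolding errors_def using card_Un_le le_trans add_le_mono1 by meson
    moreover have "card (bin_unit 3 ` {..<3}) \<le> 3" "card (quat_unit 6 ` {..<6}) \<le> 6"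
      "card ((\<lambda>j. - quat_unit 6 j) ` {..<6}) \<le> 6"
      using card_image_le[of "{..<3}" "bin_unit 3"] card_image_le[of "{..<6}" "quat_unit 6"]
        card_image_le[of "{..<6}" "\<lambda>j. - quat_unit 6 j"] by simp_all
    ultimately show ?thesis by simp
  qed
  moreover have "finite (errors 3 6)" by (simp add: errors_def)
  ultimately have inj: "inj_on syndrome (errors 3 6)"
    using im card_image_le[of "errors 3 6" syndrome]
    by (intro eq_card_imp_inj_on) (simp_all add: card_cartesian_product)
  have "\<exists>!x. x \<in> errors 3 6 \<and> syndrome w = syndrome x" for w
  proof -
    have "x mod 4 \<in> {0, 1, 2, 3}" for x :: int unfolding insert_iff empty_iff by presburger
    then have "syndrome w \<in> syndrome ` errors 3 6"
      unfolding im unfolding syndrome_def by (intro SigmaI)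
    then obtain x where x: "x \<in> errors 3 6" "syndrome w = syndrome x" by blast
    show ?thesis
    proof (rule ex1I)
      show "x \<in> errors 3 6 \<and> syndrome w = syndrome x" using x by simp
      fix y assume "y \<in> errors 3 6 \<and> syndrome w = syndrome y"
      then show "y = x" using x inj_onD[OF inj, of y x] by simp
    qed
  qed
  then show ?thesis
    unfolding one_perfect_iff[OF additive_code_Cstar] vec_diff_Cstar_iff ..
qed

text \<open>The first quaternary coordinate occurs only in the first check and the last one only in
  the second, both with coefficient 1. So the checks determine these two coordinates from the rest,
  and deleting them is an isomorphism.\<close>

lemma group_iso_type_Cstar: "group_iso_type Cstar 3 4"
proof -
  define f :: "z2z4vec \<Rightarrow> z2z4vec" where "f = (\<lambda>x. (fst x, take 4 (drop 1 (snd x))))"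
  have fv: "f (vec 3 6 w) = vec 3 4 (fst w, \<lambda>j. snd w (Suc j))" for w
    by (auto simp: f_def vec_def list_eq_iff_nth_eq)
  have vecs: "\<exists>w. x = vec 3 6 w" if "x \<in> Cstar" for x
    using that additive_code_Cstar ambient_obtain_vec unfolding additive_code_def by blast
  have n3: "(\<forall>i<3. P i) \<longleftrightarrow> P 0 \<and> P 1 \<and> P 2" and n4: "(\<forall>i<4. P i) \<longleftrightarrow> P 0 \<and> P 1 \<and> P 2 \<and> P 3"
    and n6: "(\<forall>i<6. P i) \<longleftrightarrow> P 0 \<and> P 1 \<and> P 2 \<and> P 3 \<and> P 4 \<and> P 5" for P :: "nat \<Rightarrow> bool"
    by (auto simp: numeral_eq_Suc All_less_Suc)
  have "bij_betw f Cstar (ambient 3 4)"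
  proof (rule bij_betw_imageI)
    show "inj_on f Cstar"
    proof (rule inj_onI)
      fix x y assume x: "x \<in> Cstar" and y: "y \<in> Cstar" and e: "f x = f y"
      then obtain w w' where w: "x = vec 3 6 w" "y = vec 3 6 w'" using vecs by blast
      define d where "d = w - w'"
      have "4 dvd check1 d" "4 dvd check2 d"
        using x y unfolding w vec_Cstar_iff d_def check_linear by simp_all
      moreover have "2 dvd fst d 0" "2 dvd fst d 1" "2 dvd fst d 2"
        and d: "4 dvd snd d 1" "4 dvd snd d 2" "4 dvd snd d 3" "4 dvd snd d 4"
        using e unfolding w fv vec_eq_iff n3 n4 d_def by (simp_all add: eval_nat_numeral)
      moreover from calculation obtain s t m0 m1 m2 n1 n2 n3 n4 where
        "check1 d = 4 * s" "check2 d = 4 * t" "fst d 0 = 2 * m0" "fst d 1 = 2 * m1" "fst d 2 = 2 * m2"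
        "snd d 1 = 4 * n1" "snd d 2 = 4 * n2" "snd d 3 = 4 * n3" "snd d 4 = 4 * n4"
        by (elim dvdE)
      then have "snd d 0 = 4 * (s - m0 - m1 - n1 - 2 * n2 - 3 * n3 - n4)"
        "snd d 5 = 4 * (t - m1 - m2 - n1 - n2 - 2 * n3 - 3 * n4)"
        by (simp_all add: check_defs)
      then have "4 dvd snd d 0" "4 dvd snd d 5" by simp_all
      ultimately have "vec 3 6 d = vec 3 6 0" unfolding vec_eq_iff n3 n6 by simp
      then show "x = y" unfolding w d_def by (simp add: vec_eq_iff)
    qed
    show "f ` Cstar = ambient 3 4"
    proof
      show "f ` Cstar \<subseteq> ambient 3 4" using vecs fv vec_in_ambient by fastforce
      show "ambient 3 4 \<subseteq> f ` Cstar"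
      proof
        fix z assume "z \<in> ambient 3 4"
        then obtain w where w: "z = vec 3 4 w" by (rule ambient_obtain_vec)
        define n where "n = (\<lambda>j::nat. if j = 0 then - (2 * (fst w 0 + fst w 1) + snd w 0 + 2 * snd w 1 + 3 * snd w 2 + snd w 3)
          else if j = 5 then - (2 * (fst w 1 + fst w 2) + snd w 0 + snd w 1 + 2 * snd w 2 + 3 * snd w 3)
          else snd w (j - 1))"
        have "vec 3 6 (fst w, n) \<in> Cstar" unfolding vec_Cstar_iff check_defs by (simp add: n_def)
        moreover have "f (vec 3 6 (fst w, n)) = z"
          unfolding fv w vec_eq_iff by (simp add: n_def)
        ultimately show "z \<in> f ` Cstar" by blast
      qed
    qed
  qed
  moreover have "f (vadd x y) = vadd (f x) (f y)" if x: "x \<in> Cstar" and y: "y \<in> Cstar" for x y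
  proof -
    obtain w w' where "x = vec 3 6 w" "y = vec 3 6 w'" using vecs[OF x] vecs[OF y] by blast
    then show ?thesis by (simp add: vec_add[symmetric] fv) (simp add: plus_fun_def)
  qed
  ultimately show ?thesis unfolding group_iso_type_def by blast
qed

lemma has_type_Cstar: "has_type Cstar 3 6 3 4 3"
proof -
  have "fst ` Cb 3 6 Cstar = {u. set u \<subseteq> {0, 1} \<and> length u = 3}"
  proof
    show "fst ` Cb 3 6 Cstar \<subseteq> {u. set u \<subseteq> {0, 1} \<and> length u = 3}"
      by (auto simp: Cb_def Cstar_def ambient_def)
    show "{u. set u \<subseteq> {0, 1} \<and> length u = 3} \<subseteq> fst ` Cb 3 6 Cstar"
    proof
      fix u :: "nat list" assume u: "u \<in> {u. set u \<subseteq> {0, 1} \<and> length u = 3}"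
      then have "(u, replicate 6 0) \<in> ambient 3 6" by (auto simp: ambient_def)
      then obtain w where w: "(u, replicate 6 0) = vec 3 6 w" by (rule ambient_obtain_vec)
      \<comment> \<open>Any binary part extends to a codeword of order at most 2: the two end
        coordinates solve the checks with even values, the others are 0. Hence the projection is the
        whole binary space and kappa is 3.\<close>
      define n where "n = (\<lambda>j::nat. if j = 0 then - 2 * (fst w 0 + fst w 1)
          else if j = 5 then - 2 * (fst w 1 + fst w 2) else 0)"
      have "vec 3 6 (fst w, n) \<in> Cstar" unfolding vec_Cstar_iff check_defs by (simp add: n_def)
      moreover have "vadd (vec 3 6 (fst w, n)) (vec 3 6 (fst w, n)) = vzero 3 6"
        unfolding vec_add[symmetric] vec_zero[symmetric] vec_eq_iff by (simp add: n_def)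
      moreover have "fst (vec 3 6 (fst w, n)) = u" using w by (simp add: vec_def)
      ultimately show "u \<in> fst ` Cb 3 6 Cstar"
        by (intro image_eqI[of _ _ "vec 3 6 (fst w, n)"]) (simp_all add: Cb_def)
    qed
  qed
  then have "card (fst ` Cb 3 6 Cstar) = 2 ^ 3"
    using card_lists_length_eq[of "{0, 1::nat}" 3] by (simp add: eval_nat_numeral)
  then show ?thesis using additive_code_Cstar group_iso_type_Cstar by (simp add: has_type_def)
qed

section \<open>Codes with three binary and six quaternary coordinates\<close>

text \<open>Used with \<open>u = 1\<close> or \<open>u = 5\<close>, a rotation or a reflection.
  Since \<open>u * u\<close> is 1 modulo \<open>n\<close>, multiplying by \<open>u\<close> once more
  undoes it. The identity outside the range is what \<open>permutes\<close> requires.\<close>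

definition affine_perm :: "nat \<Rightarrow> nat \<Rightarrow> nat \<Rightarrow> nat \<Rightarrow> nat" where
  "affine_perm n u c i = (if i < n then (u * i + c) mod n else i)"

lemma affine_perm_permutes:
  assumes "n > 0" "u * u mod n = 1 mod n"
  shows "affine_perm n u c permutes {0..<n}"
proof (rule bij_imp_permutes)
  have "inj_on (affine_perm n u c) {0..<n}"
  proof (rule inj_onI)
    fix i j assume i: "i \<in> {0..<n}" and j: "j \<in> {0..<n}" and "affine_perm n u c i = affine_perm n u c j"
    then have "(u * i + c) mod n = (u * j + c) mod n" by (simp add: affine_perm_def)
    then have "u * i mod n = u * j mod n" by (auto simp: nat_mod_eq_iff)
    then have "u * (u * i mod n) mod n = u * (u * j mod n) mod n" by simp
    then have "(u * u) * i mod n = (u * u) * j mod n" by (simp add: mod_mult_right_eq mult.assoc)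
    then have "(u * u mod n) * i mod n = (u * u mod n) * j mod n" by (simp add: mod_mult_left_eq)
    then have "(1 * i) mod n = (1 * j) mod n" unfolding assms(2) by (simp only: mod_mult_left_eq)
    then show "i = j" using i j by simp
  qed
  moreover have "affine_perm n u c ` {0..<n} \<subseteq> {0..<n}"
    using assms(1) by (auto simp: affine_perm_def)
  ultimately show "bij_betw (affine_perm n u c) {0..<n} {0..<n}"
    by (simp add: bij_betw_def endo_inj_surj)
qed (simp add: affine_perm_def)

lemma vec_expand:
  "vec a b (w - ((\<Sum>i<a. scale (fst w i) (bin_unit a i)) + (\<Sum>j<b. scale (snd w j) (quat_unit b j)))) = vec a b 0"
proof -
  have app: "(\<Sum>i\<in>A. f i) k = (\<Sum>i\<in>A. f i k)" for f :: "nat \<Rightarrow> nat \<Rightarrow> int" and A k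
    by (induction A rule: infinite_finite_induct) auto
  have "(\<Sum>i<a. fst w i * of_bool (k mod a = i mod a)) = fst w k" if "k < a" for k
  proof -
    have "(\<Sum>i<a. fst w i * of_bool (k mod a = i mod a)) = (\<Sum>i<a. if k = i then fst w i else 0)"
      using that by (intro sum.cong) auto
    then show ?thesis using that by simp
  qed
  moreover have "(\<Sum>i<b. snd w i * of_bool (k mod b = i mod b)) = snd w k" if "k < b" for k
  proof -
    have "(\<Sum>i<b. snd w i * of_bool (k mod b = i mod b)) = (\<Sum>i<b. if k = i then snd w i else 0)"
      using that by (intro sum.cong) auto
    then show ?thesis using that by simp
  qed
  ultimately show ?thesis
    by (auto simp: vec_eq_iff fst_sum snd_sum app scale_def bin_unit_def quat_unit_def)
qed

locale cyclic_perfect_code_3_6 =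
  cyclic_perfect S "bin_unit 3" "quat_unit 6" "shift 3 6" 3 6 for S +
  fixes C :: "z2z4vec set"
  assumes S_def: "S = {w. vec 3 6 w \<in> C}" and additive: "additive_code 3 6 C"
begin

text \<open>Over the basis \<open>Q 0\<close>, \<open>Q 5\<close> the recurrence gives the
  coordinate pairs (1,0), (1,1), (2,1), (3,2), (5,3), (0,1), which modulo 4 are the quaternary
  columns of \<open>h1\<close> over \<open>h2\<close>. The binary classes, being doubles, give the
  binary columns times 2. So lying in the code means that both checks vanish modulo 4 after
  relabelling.\<close>

lemma perm_equiv_Cstar: "perm_equiv 3 6 C Cstar"
proof -
  have scale_S: "scale k w \<in> S" if "w \<in> S" for k w
    using scale_mem[of S w k] zero_mem add_mem uminus_mem that by blast
  have scale_eqv: "scale k x \<approx> scale k y" if "x \<approx> y" for k x y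
    using scale_S[of "x - y" k] that by (simp add: eqv_def scale_diff_right)
  \<comment> \<open>The sign in the recurrence decides the direction \<open>u\<close>;
    \<open>c2\<close> is the starting index, and doubling forces \<open>c1\<close> to be
    \<open>offset + c2\<close> modulo 3.\<close>
  have "\<exists>u c1 c2. u * u mod 3 = 1 mod 3 \<and> u * u mod 6 = 1 mod 6 \<and>
      (\<forall>j. quat_unit 6 (u * (j + 2) + c2) \<approx> quat_unit 6 (u * (j + 1) + c2) + quat_unit 6 (u * j + c2)) \<and>
      (\<forall>j. quat_unit 6 (u * j + c2) + quat_unit 6 (u * j + c2) \<approx> bin_unit 3 (u * j + c1))"
    using recurrence[OF refl refl]
  proof
    assume r: "\<forall>k. quat_unit 6 (k + 2) \<approx> quat_unit 6 k + quat_unit 6 (k + 1)"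
    have "quat_unit 6 (1 * (j + 2) + 1) \<approx> quat_unit 6 (1 * (j + 1) + 1) + quat_unit 6 (1 * j + 1)" for j
      using r[rule_format, of "j + 1"] by (simp add: add.commute add.left_commute)
    moreover have "quat_unit 6 (1 * j + 1) + quat_unit 6 (1 * j + 1) \<approx> bin_unit 3 (1 * j + (offset + 1))" for j
      using q_double[of "j + 1"] by (simp add: add.commute add.left_commute)
    ultimately show ?thesis
      by (intro exI[of _ 1] exI[of _ "offset + 1"] conjI) (auto simp del: One_nat_def)
  next
    assume r: "\<forall>k. quat_unit 6 (k + 2) \<approx> quat_unit 6 k - quat_unit 6 (k + 1)"
    have "quat_unit 6 (5 * (j + 2) + 0) \<approx> quat_unit 6 (5 * (j + 1) + 0) + quat_unit 6 (5 * j + 0)" for j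
    proof -
      \<comment> \<open>The relation at \<open>5 * j + 4\<close> involves the indices
        \<open>5 * j + 4\<close>, \<open>5 * j + 5\<close> and \<open>5 * j + 6\<close>; modulo 6
        these are 5 times \<open>j + 2\<close>, \<open>j + 1\<close> and \<open>j\<close>.\<close>
      have "quat_unit 6 (5 * j + 4 + 2) = quat_unit 6 (5 * j)" "quat_unit 6 (5 * (j + 2)) = quat_unit 6 (5 * j + 4)"
        "quat_unit 6 (5 * (j + 1)) = quat_unit 6 (5 * j + 4 + 1)"
        using q_periodic[of "5 * j"] q_periodic[of "5 * j + 4"] by (simp_all add: algebra_simps)
      then show ?thesis
        using uminus_mem[OF r[rule_format, of "5 * j + 4", unfolded eqv_def]] by (simp add: eqv_def algebra_simps)
    qed
    moreover have "quat_unit 6 (5 * j + 0) + quat_unit 6 (5 * j + 0) \<approx> bin_unit 3 (5 * j + offset)" for j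
      using q_double[of "5 * j"] by (simp add: add.commute)
    ultimately show ?thesis
      by (intro exI[of _ 5] exI[of _ offset] exI[of _ 0] conjI) auto
  qed
  then obtain u c1 c2 where u: "u * u mod 3 = 1 mod 3" "u * u mod 6 = 1 mod 6"
    and rec: "\<And>j. quat_unit 6 (u * (j + 2) + c2) \<approx> quat_unit 6 (u * (j + 1) + c2) + quat_unit 6 (u * j + c2)"
    and dbl: "\<And>j. quat_unit 6 (u * j + c2) + quat_unit 6 (u * j + c2) \<approx> bin_unit 3 (u * j + c1)"
    by blast
  \<comment> \<open>The columns of the matrix with rows \<open>h1\<close>, \<open>h2\<close> satisfy the recurrence $Q_{j+2} = Q_{j+1} + Q_j$
    cyclically; when \<open>q\<close> satisfies it with the other sign, it is read backwards ($5 \equiv -1$ mod 6).\<close>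
  define Q where "Q j = quat_unit 6 (u * j + c2)" for j
  define E where "E i = bin_unit 3 (u * i + c1)" for i
  have Q_rec: "Q (j + 2) \<approx> Q (j + 1) + Q j" for j using rec by (simp add: Q_def)
  have Q_dbl: "Q j + Q j \<approx> E j" for j using dbl by (simp add: Q_def E_def)
  have Q_per: "Q (j + 6) = Q j" for j
    unfolding Q_def quat_unit_eq_iff using mod_mult_self1[of "u * j + c2" u 6]
    by (simp add: algebra_simps del: mod_mult_self1 mod_mult_self2 mod_mult_self3 mod_mult_self4)
  have E_per: "E (j + 3) = E j" for j
    unfolding E_def bin_unit_eq_iff using mod_mult_self1[of "u * j + c1" u 3]
    by (simp add: algebra_simps del: mod_mult_self1 mod_mult_self2 mod_mult_self3 mod_mult_self4)
  have E02: "\<not> E 0 \<approx> E 2"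
  proof
    assume "E 0 \<approx> E 2"
    then have "(u * 0 + c1) mod 3 = (u * 2 + c1) mod 3"
      by (simp add: E_def e_eqv_iff)
    then have "u mod 3 = 0" by presburger
    then have "u * u mod 3 = 0" by (metis mod_mult_left_eq mult_zero_left mod_0)
    then show False using u(1) by simp
  qed
  \<comment> \<open>The relation is between \<open>E 0\<close> and \<open>E 2\<close>, since
    \<open>E\<close> has period 3. These are distinct classes of order 2, hence independent over the
    field with two elements.\<close>
  have even_coeffs: "even m \<and> even n" if X: "scale m (Q 0 + Q 0) + scale n (Q 5 + Q 5) \<in> S" for m n
  proof -
    have E5: "E 5 = E 2" using E_per[of 2] by simp
    have EE: "E i + E i \<in> S" for i unfolding E_def by (rule e_double)
    have scale_E: "scale k (E i) \<approx> (if even k then 0 else E i)" for k i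
    proof (cases "even k")
      case True
      then obtain l where "k = 2 * l" by (rule evenE)
      then have "scale k (E i) = scale l (E i + E i)" by (simp only: mult_2 scale_add_left scale_add_right)
      then show ?thesis using True scale_S[OF EE] by (simp add: eqv_def)
    next
      case False
      then obtain l where "k = 2 * l + 1" by (rule oddE)
      then have "scale k (E i) = scale l (E i + E i) + E i"
        by (simp only: mult_2 scale_add_left scale_add_right scale_1)
      then show ?thesis using False scale_S[OF EE] by (simp add: eqv_def)
    qed
    have "scale m (Q 0 + Q 0) + scale n (Q 5 + Q 5) \<approx> scale m (E 0) + scale n (E 2)"
      using eqv_add[OF scale_eqv[OF Q_dbl] scale_eqv[OF Q_dbl]] E5 by metis
    also have "\<dots> \<approx> (if even m then 0 else E 0) + (if even n then 0 else E 2)"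
      by (intro eqv_add scale_E)
    finally have "(if even m then 0 else E 0) + (if even n then 0 else E 2) \<in> S"
      using X eqv_mem eqv_sym by blast
    moreover have "E i \<notin> S" for i unfolding E_def by (rule e_notin)
    moreover have "E 0 + E 2 \<notin> S"
    proof
      assume "E 0 + E 2 \<in> S"
      then have "E 0 \<approx> E 2" using diff_mem[OF _ EE[of 2]] by (fastforce simp: eqv_def)
      then show False using E02 by simp
    qed
    ultimately show ?thesis by (auto split: if_splits)
  qed
  have scale_4_Q: "scale 4 (Q j) \<in> S" for j
  proof -
    have "scale 4 (Q j) = Q j + Q j + (Q j + Q j)"
      using scale_add_left[of 2 2 "Q j"] scale_add_left[of 1 1 "Q j"] by simp
    then show ?thesis using q_quadruple by (simp add: Q_def)
  qed
  \<comment> \<open>\<open>Q 0\<close> and \<open>Q 5\<close> are independent modulo 4. Doubling a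
    relation shows that its coefficients are even; the relation itself is then one between doubles,
    so the halved coefficients are even again.\<close>
  have indep: "scale m (Q 0) + scale n (Q 5) \<in> S \<longleftrightarrow> 4 dvd m \<and> 4 dvd n" for m n
  proof
    assume X: "scale m (Q 0) + scale n (Q 5) \<in> S"
    have "scale m (Q 0 + Q 0) + scale n (Q 5 + Q 5) \<in> S"
      using add_mem[OF X X] by (simp add: scale_add_right algebra_simps)
    then obtain k l where kl: "m = 2 * k" "n = 2 * l" using even_coeffs by (meson evenE)
    have "scale k (Q 0 + Q 0) + scale l (Q 5 + Q 5) \<in> S"
      using X unfolding kl by (simp only: mult_2 scale_add_right scale_add_left)
    then have "even k" "even l" using even_coeffs by blast+
    then show "4 dvd m \<and> 4 dvd n" unfolding kl by presburger
  next
    assume "4 dvd m \<and> 4 dvd n"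
    then obtain k l where "m = k * 4" "n = l * 4" by (metis dvdE mult.commute)
    then show "scale m (Q 0) + scale n (Q 5) \<in> S"
      using add_mem[OF scale_S[OF scale_4_Q] scale_S[OF scale_4_Q]] by (metis scale_scale)
  qed
  define comb where "comb m n = scale m (Q 0) + scale n (Q 5)" for m n
  have comb_add: "comb m n + comb m' n' = comb (m + m') (n + n')" for m n m' n'
    by (simp add: comb_def scale_add_left)
  have scale_comb: "scale k (comb m n) = comb (k * m) (k * n)" for k m n
    by (simp add: comb_def scale_add_right scale_scale)
  have step: "Q (j + 2) \<approx> comb (m + k) (n + l)"
    if "Q (j + 1) \<approx> comb m n" "Q j \<approx> comb k l" for j m n k l
    using eqv_trans[OF Q_rec eqv_add[OF that]] by (simp add: comb_add)
  have Q0: "Q 0 \<approx> comb 1 0" and Q5: "Q 5 \<approx> comb 0 1"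
    by (simp_all add: comb_def)
  \<comment> \<open>The recurrence starts across the wrap-around, at \<open>j = 5\<close>, with
    \<open>Q 6 = Q 0\<close> and \<open>Q 7 = Q 1\<close>.\<close>
  have Q1: "Q 1 \<approx> comb 1 1" using step[of 5 1 0 0 1] Q0 Q5 Q_per[of 0] Q_per[of 1] by simp
  have Q2: "Q 2 \<approx> comb 2 1" using step[of 0 1 1 1 0] Q1 Q0 by (simp add: numeral_eq_Suc)
  have Q3: "Q 3 \<approx> comb 3 2" using step[of 1 2 1 1 1] Q2 Q1 by (simp add: numeral_eq_Suc)
  have Q4: "Q 4 \<approx> comb 5 3" using step[of 2 3 2 2 1] Q3 Q2 by (simp add: numeral_eq_Suc)
  have E_comb: "E j \<approx> comb (m + m) (n + n)" if "Q j \<approx> comb m n" for j m n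
    using eqv_trans[OF eqv_sym[OF Q_dbl] eqv_add[OF that that]] by (simp add: comb_add)
  have scale_eqv_comb: "scale k x \<approx> comb (k * m) (k * n)" if "x \<approx> comb m n" for k x m n
    using scale_eqv[OF that, of k] by (simp add: scale_comb)
  define p where "p = affine_perm 3 u c1"
  define r where "r = affine_perm 6 u c2"
  have p: "p permutes {0..<3}" and r: "r permutes {0..<6}"
    unfolding p_def r_def using u by (auto intro: affine_perm_permutes)
  have key: "vec 3 6 w \<in> C \<longleftrightarrow> vec 3 6 (fst w \<circ> p, snd w \<circ> r) \<in> Cstar" for w
  proof -
    define m where "m = fst w \<circ> p"
    define n where "n = snd w \<circ> r"
    have l: "{0..<3} = {0, 1, 2::nat}" "{0..<6} = {0, 1, 2, 3, 4, 5::nat}" by auto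
    have unit: "bin_unit 3 (p i) = E i" "quat_unit 6 (r j) = Q j" if "i < 3" "j < 6" for i j
      using that by (simp_all add: p_def r_def affine_perm_def E_def Q_def bin_unit_mod quat_unit_mod)
    have "w \<approx> (\<Sum>i<3. scale (fst w i) (bin_unit 3 i)) + (\<Sum>j<6. scale (snd w j) (quat_unit 6 j))"
      using vec_expand[of 3 6 w] zero_mem unfolding eqv_def by (simp add: S_def)
    also have "(\<Sum>i<3. scale (fst w i) (bin_unit 3 i)) = (\<Sum>i\<in>{0..<3}. scale (m i) (E i))"
    proof -
      have "(\<Sum>i<3. scale (fst w i) (bin_unit 3 i)) = sum ((\<lambda>i. scale (fst w i) (bin_unit 3 i)) \<circ> p) {0..<3}"
        unfolding lessThan_atLeast0 by (rule sum.permute[OF p])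
      also have "\<dots> = (\<Sum>i\<in>{0..<3}. scale (m i) (E i))"
        by (rule sum.cong) (simp_all add: m_def unit(1)[of _ 0])
      finally show ?thesis .
    qed
    also have "(\<Sum>j<6. scale (snd w j) (quat_unit 6 j)) = (\<Sum>j\<in>{0..<6}. scale (n j) (Q j))"
    proof -
      have "(\<Sum>j<6. scale (snd w j) (quat_unit 6 j)) = sum ((\<lambda>j. scale (snd w j) (quat_unit 6 j)) \<circ> r) {0..<6}"
        unfolding lessThan_atLeast0 by (rule sum.permute[OF r])
      also have "\<dots> = (\<Sum>j\<in>{0..<6}. scale (n j) (Q j))"
        by (rule sum.cong) (simp_all add: n_def unit(2)[of 0])
      finally show ?thesis .
    qed
    also have "(\<Sum>i\<in>{0..<3}. scale (m i) (E i)) + (\<Sum>j\<in>{0..<6}. scale (n j) (Q j)) =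
        scale (m 0) (E 0) + scale (m 1) (E 1) + scale (m 2) (E 2) +
        (scale (n 0) (Q 0) + scale (n 1) (Q 1) + scale (n 2) (Q 2) + scale (n 3) (Q 3) + scale (n 4) (Q 4) + scale (n 5) (Q 5))"
      unfolding l by (simp add: add.assoc)
    also have "\<dots> \<approx>
        comb (m 0 * (1 + 1)) (m 0 * (0 + 0)) + comb (m 1 * (1 + 1)) (m 1 * (1 + 1)) +
          comb (m 2 * (2 + 2)) (m 2 * (1 + 1)) +
        (comb (n 0 * 1) (n 0 * 0) + comb (n 1 * 1) (n 1 * 1) + comb (n 2 * 2) (n 2 * 1) +
          comb (n 3 * 3) (n 3 * 2) + comb (n 4 * 5) (n 4 * 3) + comb (n 5 * 0) (n 5 * 1))"
      by (intro eqv_add scale_eqv_comb E_comb Q0 Q1 Q2 Q3 Q4 Q5)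
    \<comment> \<open>The coefficients were left unreduced: \<open>E 2\<close> contributes (4,2) and
      \<open>Q 4\<close> contributes (5,3), where the first check has 0 and 1. This is the surplus
      multiple of 4.\<close>
    also have "\<dots> = comb (check1 (m, n) + 4 * (m 2 + n 4)) (check2 (m, n))"
      unfolding comb_add by (rule arg_cong2[where f = comb]) (simp_all add: check_defs)
    finally have "w \<in> S \<longleftrightarrow> comb (check1 (m, n) + 4 * (m 2 + n 4)) (check2 (m, n)) \<in> S"
      using eqv_mem eqv_sym by blast
    also have "\<dots> \<longleftrightarrow> 4 dvd check1 (m, n) \<and> 4 dvd check2 (m, n)"
      unfolding comb_def indep by (simp add: dvd_add_left_iff)
    finally show ?thesis by (simp add: S_def m_def n_def vec_Cstar_iff)
  qed
  \<comment> \<open>By \<open>key\<close>, composing with \<open>p\<close> and \<open>r\<close>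
    leads from \<open>C\<close> to \<open>Cstar\<close>; \<open>perm_equiv\<close> asks for
    \<open>C\<close> as an image of \<open>Cstar\<close>, hence the inverses.\<close>
  have pi: "inv p permutes {0..<3}" and ri: "inv r permutes {0..<6}"
    using p r by (simp_all add: permutes_inv)
  define P where "P = (\<lambda>x::z2z4vec. (permute_list_by (inv p) (fst x), permute_list_by (inv r) (snd x)))"
  have P_vec: "P (vec 3 6 w) = vec 3 6 (fst w \<circ> inv p, snd w \<circ> inv r)" for w
    by (simp add: P_def vec_def permute_list_by_map[OF pi] permute_list_by_map[OF ri] comp_def)
  have "C = P ` Cstar"
  proof (intro equalityI subsetI)
    fix x assume x: "x \<in> C"
    then obtain w where w: "x = vec 3 6 w"
      using additive ambient_obtain_vec unfolding additive_code_def by blast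
    have "P (vec 3 6 (fst w \<circ> p, snd w \<circ> r)) = x"
      unfolding P_vec w by (simp add: comp_assoc permutes_inv_o[OF p] permutes_inv_o[OF r])
    moreover have "vec 3 6 (fst w \<circ> p, snd w \<circ> r) \<in> Cstar" using x w key by simp
    ultimately show "x \<in> P ` Cstar" by blast
  next
    fix x assume "x \<in> P ` Cstar"
    then obtain y where y: "y \<in> Cstar" "x = P y" by blast
    then obtain w where w: "y = vec 3 6 w"
      using additive_code_Cstar ambient_obtain_vec unfolding additive_code_def by blast
    show "x \<in> C"
      using y unfolding w P_vec y(2)
      by (simp add: key comp_assoc permutes_inv_o[OF p] permutes_inv_o[OF r])
  qed
  then show ?thesis
    unfolding perm_equiv_def P_def using pi ri by blast
qed

end

theorem theorem3p11:
  shows "(\<forall>(a::nat) (b::nat) C.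
            a \<ge> 1 \<and> additive_code a b C \<and> z2z4_one_perfect a b C \<and>
            \<not> binary_linear (a + 2 * b) (Gray ` C) \<and> z2z4_cyclic C
          \<longrightarrow> a = 3 \<and> b = 6 \<and> has_type C 3 6 3 4 3 \<and> perm_equiv 3 6 C Cstar)
       \<and> (additive_code 3 6 Cstar \<and> z2z4_cyclic Cstar \<and> z2z4_one_perfect 3 6 Cstar
          \<and> has_type Cstar 3 6 3 4 3)"
proof (intro conjI[OF _ conjI[OF additive_code_Cstar conjI[OF z2z4_cyclic_Cstar
        conjI[OF z2z4_one_perfect_Cstar has_type_Cstar]]]] allI impI, elim conjE)
  fix a b C
  assume "1 \<le> a" and C: "additive_code a b C" and "z2z4_one_perfect a b C"
    and nonlinear: "\<not> binary_linear (a + 2 * b) (Gray ` C)" and "z2z4_cyclic C"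
  moreover have "b \<noteq> 0" using C nonlinear binary_linear_no_quaternary by metis
  ultimately have cp: "cyclic_perfect {w. vec a b w \<in> C} (bin_unit a) (quat_unit b) (shift a b) a b"
    by (intro cyclic_perfect_instance) simp_all
  have "\<not> (a = 1 \<and> b = 1)" using C cp nonlinear binary_linear_1_1 by metis
  then have ab: "a = 3" "b = 6" using cyclic_perfect.parameters[OF cp] by blast+
  have "perm_equiv 3 6 C Cstar"
    using cyclic_perfect_code_3_6.perm_equiv_Cstar[OF cyclic_perfect_code_3_6.intro
        [OF cp[unfolded ab] cyclic_perfect_code_3_6_axioms.intro]] C ab by simp
  then show "a = 3 \<and> b = 6 \<and> has_type C 3 6 3 4 3 \<and> perm_equiv 3 6 C Cstar"
    using ab C has_type_Cstar has_type_perm_equiv by blast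
qed

end
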